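(* Let $M$ be the set of real numbers $x\in(0,1)$ defined as follows. Take any infinite sequence $A_1,A_2,A_3,\ldots$ of finite (possibly empty) sequences of positive integers, and any sequence of positive integers $\tau_1,\tau_2,\ldots$, and let $$x=[A_1,\tau_1,A_2,\tau_2,A_3,\tau_3,\ldots]$$ be the infinite continued fraction whose sequence of partial quotients is the concatenation $A_1,\tau_1,A_2,\tau_2,\ldots$. Such an $x$ belongs to $M$ if and only if for every $k\in\mathbb{Z}_+$ one has $$\tau_k=\sigma_{A_k}+s_k\quad\text{for some } s_k\in\mathbb{Z}_+ \text{ with } s_k>(\kappa_2-1)S_{A_{k+1}}+\sigma_{A_k}+2 .$$ Then for every $x_0\in M$ and every $n\in\mathbb{Z}_+$, the derivative $f_n'(x_0)$ exists and $f_n'(x_0)=0$, where $f_n=\underbrace{?\circ ?\circ\cdots\circ ?}_{n\text{ times}}$ is the $n$-th iterate of the Minkowski question mark function.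
   Context: $\mathbb{Z}_+$ denotes the positive integers. For $x\in[0,1]$, $x=[a_1,a_2,\ldots]=\cfrac{1}{a_1+\cfrac{1}{a_2+\cdots}}$ with $a_j\in\mathbb{Z}_+$ is its regular continued fraction expansion. The Minkowski question mark function $?:[0,1]\to[0,1]$ is given for irrational $x=[a_1,a_2,\ldots]$ by $?(x)=\sum_{k=1}^{\infty}\frac{(-1)^{k+1}}{2^{a_1+\cdots+a_k-1}}$, and for rational $x$ by $?([a_1,\ldots,a_t+1])=?([a_1,\ldots,a_t,1])=\sum_{k=1}^{t}\frac{(-1)^{k+1}}{2^{a_1+\cdots+a_k-1}}$ (with $?(0)=0$, $?(1)=1$); it is continuous and strictly increasing. For a finite sequence $A=(a_1,\ldots,a_m)$ of positive integers, $S_A=a_1+\cdots+a_m$ (with $S_A=0$ if $A$ is empty). For $x=[A_1,\tau_1,A_2,\tau_2,\ldots]$ as in the claim, $\sigma_{A_k}=S_{A_1}+\tau_1+S_{A_2}+\tau_2+\cdots+\tau_{k-1}+S_{A_k}$ (the sum of all partial quotients up to and including the block $A_k$). The constant $\kappa_2=\frac{4L_5-5L_4}{L_5-L_4}=4.401\ldots$, where $L_j=\log\frac{j+\sqrt{j^2+4}}{2}-j\cdot\frac{\log 2}{2}$ for $j=4,5$.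
   Formalization: For rational x, ?(x) is taken as the alternating sum over all partial quotients of a finite expansion (the standard continuous function); the formula given for ?([a_1,…,a_t+1]) would yield ?(1/2)=1=?(1), contradicting strict monotonicity. *)

theory Defs
  imports Complex_Main
begin

fun cf_fin :: "nat list \<Rightarrow> real" where
  "cf_fin [] = 0"
| "cf_fin (a # as) = 1 / (real a + cf_fin as)"

definition is_cf :: "(nat \<Rightarrow> nat) \<Rightarrow> real \<Rightarrow> bool" where
  "is_cf a x \<longleftrightarrow>
     (\<forall>j. 0 < a j) \<and> (\<lambda>n. cf_fin (map a [0..<n])) \<longlonglongrightarrow> x"

text \<open>
  The Minkowski question mark function. Sequences are indexed from \<open>0\<close>, so the summand with
  index \<open>k\<close> is $(-1)^{k+2} / 2^{a_1 + \cdots + a_{k+1} - 1}$ in the usual one-based notation.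
  A rational number in $(0,1)$ has exactly two expansions, $[a_1, \ldots, a_t + 1]$ and
  $[a_1, \ldots, a_t, 1]$; the alternating sum over all partial quotients has the same value
  for both, so the definite description is proper. The empty expansion gives the value \<open>0\<close>
  at \<open>0\<close>. The values outside $[0,1]$ are unspecified.
\<close>

definition question_mark :: "real \<Rightarrow> real" where
  "question_mark x =
     (if x \<in> \<rat>
      then THE y. \<exists>as. (\<forall>a\<in>set as. 0 < a) \<and> x = cf_fin as \<and>
             y = (\<Sum>k<length as. (-1) ^ k / 2 ^ (sum_list (take (Suc k) as) - 1))
      else THE y. \<exists>a. is_cf a x \<and>
             (\<lambda>k. (-1) ^ k / 2 ^ ((\<Sum>j\<le>k. a j) - 1)) sums y)"

definition L_const :: "real \<Rightarrow> real" where
  "L_const j = ln ((j + sqrt (j\<^sup>2 + 4)) / 2) - j * (ln 2 / 2)"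

definition kappa2 :: real where
  "kappa2 = (4 * L_const 5 - 5 * L_const 4) / (L_const 5 - L_const 4)"

text \<open>
  The infinite concatenation $A_0, \tau_0, A_1, \tau_1, \ldots$: every block \<open>A k @ [\<tau> k]\<close> is
  nonempty, so the first \<open>n + 1\<close> blocks together have an entry with index \<open>n\<close>.
\<close>

definition block_seq :: "(nat \<Rightarrow> nat list) \<Rightarrow> (nat \<Rightarrow> nat) \<Rightarrow> nat \<Rightarrow> nat" where
  "block_seq A \<tau> n = concat (map (\<lambda>k. A k @ [\<tau> k]) [0..<Suc n]) ! n"

definition block_sigma :: "(nat \<Rightarrow> nat list) \<Rightarrow> (nat \<Rightarrow> nat) \<Rightarrow> nat \<Rightarrow> nat" where
  "block_sigma A \<tau> k = (\<Sum>i<k. sum_list (A i) + \<tau> i) + sum_list (A k)"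

definition M_set :: "real set" where
  "M_set = {x \<in> {0<..<1}. \<exists>A \<tau>.
     (\<forall>k. \<forall>a\<in>set (A k). 0 < a) \<and> (\<forall>k. 0 < \<tau> k) \<and>
     is_cf (block_seq A \<tau>) x \<and>
     (\<forall>k. \<exists>s>0. \<tau> k = block_sigma A \<tau> k + s \<and>
        real s > (kappa2 - 1) * real (sum_list (A (Suc k))) + real (block_sigma A \<tau> k) + 2)}"

end

theory Submission imports Defs begin

text \<open>
  Near a rational \<open>p/q\<close> the question mark function is extremely flat: if $?(p/q)$ has denominator
  $2^m$, then $|?(z) - ?(p/q)| \le 4 \cdot 2^{-m - w}$, where $w = 1/(q^2 |z - p/q|)$. So if \<open>y\<close> has
  approximants $p_k/q_k$ whose quality $w_k$ is large compared with $\log q_{k+1}$, then $?'(y) = 0$.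
  Moreover $?(p_k/q_k)$ approximates $?(y)$ with quality at least $2^{w_k - m_k - 2}$, and therefore
  the condition ``$w_k \ge 8 q_k$ and $q_{k+1} \le 2^{w_k/4}$'' is inherited by $?(y)$. For $x \in M$
  the approximants $[A_1, \tau_1, \ldots, A_k]$ have quality at least $\tau_k$, which gives
  $?'(x) = 0$ as well as the inherited condition for $?(x)$; the chain rule does the rest.
\<close>

section \<open>Values of the question mark function on continued fractions\<close>

text \<open>The inherited condition cannot be started at \<open>x\<close> itself: there the quality
  is only known to be at least tau_k, a bound that may be linear in S_k = sigma_{A_k}, while q_k can
  be exponential in S_k. So \<open>x\<close> gets an estimate of its own. With t_k = S_{A_{k+1}},
  the number q_{k+1} is at most 2^(S_k + t_k) up to a factor tau_k + 1, and flatness needs S_k + 2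
  t_k to stay below (4/5) tau_k with room for logarithms. From kappa2 >= 4 one gets tau_k >= 2 S_k +
  3 t_k + 3, so that S_k + 2 t_k <= (2/3) tau_k. After one application of ? the denominator is
  exactly 2^(S_k - 1) and the quality at least 2^(tau_k - S_k - 1), which is enough for the
  inherited condition. Good approximants at infinitely many scales would not suffice for a
  derivative: every small distance h must be served by one of them. Hence the upper bound on q_{k+1}
  in terms of w_k.\<close>

definition qm_list :: "nat list \<Rightarrow> real" where
  "qm_list as = (\<Sum>k<length as. (-1) ^ k / 2 ^ (sum_list (take (Suc k) as) - 1))"

lemma qm_list_Nil [simp]: "qm_list [] = 0"
  by (simp add: qm_list_def)

text \<open>Moving every later term behind the digit \<open>a\<close> costs a factor 2^(-a) and one
  sign. This recursion frees the later arguments from the truncated subtraction in the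
  exponents.\<close>

lemma qm_list_Cons:
  assumes "0 < a" "\<forall>a\<in>set as. 0 < a"
  shows "qm_list (a # as) = 2 / 2 ^ a - qm_list as / 2 ^ a"
proof -
  have term_shift: "(-1) ^ Suc k / 2 ^ (sum_list (take (Suc (Suc k)) (a # as)) - 1)
      = - ((-1) ^ k / 2 ^ (sum_list (take (Suc k) as) - 1)) / (2 ^ a :: real)"
    if "k < length as" for k
  proof -
    \<comment> \<open>A positive head of the tail makes the sum positive, so that subtracting 1 is
      exact.\<close>
    have "as \<noteq> []"
      using that by auto
    then obtain b bs where as: "as = b # bs"
      by (meson neq_Nil_conv)
    have "sum_list (take (Suc (Suc k)) (a # as)) - 1 = a + (sum_list (take (Suc k) as) - 1)"
      using assms unfolding as by simp
    then show ?thesis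
      by (simp add: power_add)
  qed
  have "qm_list (a # as) = 1 / 2 ^ (a - 1) +
      (\<Sum>k<length as. (-1) ^ Suc k / 2 ^ (sum_list (take (Suc (Suc k)) (a # as)) - 1))"
    unfolding qm_list_def by (simp add: sum.lessThan_Suc_shift del: sum.lessThan_Suc)
  also have "(\<Sum>k<length as. (-1) ^ Suc k / 2 ^ (sum_list (take (Suc (Suc k)) (a # as)) - 1))
      = - qm_list as / 2 ^ a"
    unfolding qm_list_def
    unfolding sum_divide_distrib sum_negf[symmetric]
    by (intro sum.cong refl term_shift) simp
  also have "1 / 2 ^ (a - 1) = 2 / (2 ^ a :: real)"
    using assms by (cases a) auto
  finally show ?thesis
    by simp
qed

lemma qm_list_bounds:
  assumes "\<forall>a\<in>set as. 0 < a"
  shows "0 \<le> qm_list as \<and> qm_list as \<le> 1"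
  using assms
proof (induction as)
  case (Cons a as)
  have "(2::real) ^ 1 \<le> 2 ^ a"
    using Cons.prems by (intro power_increasing) auto
  then show ?case
    using Cons by (simp add: qm_list_Cons diff_divide_distrib[symmetric] divide_simps)
qed auto

text \<open>After scaling, the recursion reads even minus odd. The lemma pins down the exact
  denominator of the value, which later identifies the level of a convergent.\<close>

lemma odd_qm_list:
  assumes "\<forall>a\<in>set as. 0 < a" "as \<noteq> []"
  shows "\<exists>P::int. odd P \<and> 2 ^ (sum_list as - 1) * qm_list as = of_int P"
  using assms
proof (induction as)
  case (Cons a as)
  show ?case
  proof (cases "as = []")
    case True
    have "2 ^ (a - 1) * (2 / 2 ^ a) = (1::real)"
      using Cons.prems by (cases a) auto
    then show ?thesis
      using True Cons.prems by (intro exI[of _ 1]) (simp add: qm_list_Cons)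
  next
    case False
    then obtain P :: int where P: "odd P" "2 ^ (sum_list as - 1) * qm_list as = of_int P"
      using Cons by auto
    obtain b bs where "as = b # bs"
      using False by (cases as) auto
    then have pos: "0 < sum_list as"
      using Cons.prems by simp
    then have "2 ^ (sum_list (a # as) - 1) = (2::real) ^ a * 2 ^ (sum_list as - 1)"
      by (simp flip: power_add)
    then have "2 ^ (sum_list (a # as) - 1) * qm_list (a # as)
        = 2 * 2 ^ (sum_list as - 1) - 2 ^ (sum_list as - 1) * qm_list as"
      using Cons.prems by (simp add: qm_list_Cons field_simps)
    then have "2 ^ (sum_list (a # as) - 1) * qm_list (a # as)
        = of_int (2 * 2 ^ (sum_list as - 1) - P)"
      using P by simp
    moreover have "odd (2 * 2 ^ (sum_list as - 1) - P)"
      using P by simp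
    ultimately show ?thesis
      by blast
  qed
qed auto

section \<open>Finite expansions and rational arguments\<close>

lemma cf_fin_bounds:
  assumes "\<forall>a\<in>set as. 0 < a"
  shows "0 \<le> cf_fin as \<and> cf_fin as \<le> 1 \<and> (as \<noteq> [] \<longrightarrow> 0 < cf_fin as)"
  using assms by (induction as) (auto simp: divide_simps intro: add_pos_nonneg)

lemma cf_fin_eq_0_iff:
  assumes "\<forall>a\<in>set as. 0 < a"
  shows "cf_fin as = 0 \<longleftrightarrow> as = []"
  using cf_fin_bounds[OF assms] by auto

lemma cf_fin_eq_1:
  assumes "\<forall>a\<in>set as. 0 < a" "cf_fin as = 1"
  shows "as = [1]"
proof (cases as)
  case (Cons a bs)
  have pos: "\<forall>a\<in>set bs. 0 < a" "0 < a"
    using assms Cons by auto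
  have "real a + cf_fin bs = 1"
    using assms(2) Cons by (simp add: divide_simps split: if_splits)
  moreover have "0 \<le> cf_fin bs" "1 \<le> real a"
    using cf_fin_bounds[OF pos(1)] pos by auto
  ultimately have "cf_fin bs = 0" "a = 1"
    by linarith+
  then show ?thesis
    using cf_fin_eq_0_iff[OF pos(1)] Cons by simp
qed (use assms in auto)

lemma cf_fin_less_1:
  assumes "\<forall>a\<in>set as. 0 < a" "2 \<le> sum_list as"
  shows "cf_fin as < 1"
  using cf_fin_bounds[OF assms(1)] cf_fin_eq_1[OF assms(1)] assms(2) by fastforce

text \<open>At the first differing digits c < d the tails lie in [0,1], which forces d = c + 1 with
  tails 1 and 0, that is [.., c, 1] against [.., c + 1]; both give the same value. This is what
  makes the definite description at rationals proper.\<close>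

lemma qm_list_cong:
  assumes "\<forall>a\<in>set as. 0 < a" "\<forall>b\<in>set bs. 0 < b" "cf_fin as = cf_fin bs"
  shows "qm_list as = qm_list bs"
  using assms
proof (induction as arbitrary: bs)
  case Nil
  then show ?case
    using cf_fin_eq_0_iff[of bs] by simp
next
  case (Cons a as)
  then have "cf_fin bs \<noteq> 0"
    using cf_fin_eq_0_iff[of "a # as"] by simp
  then obtain b cs where bs: "bs = b # cs"
    by (cases bs) auto
  have pos: "\<forall>a\<in>set as. 0 < a" "\<forall>b\<in>set cs. 0 < b" "0 < a" "0 < b"
    using Cons.prems bs by auto
  have key: "qm_list (c # us) = qm_list (d # vs)"
    if "\<forall>a\<in>set us. 0 < a" "\<forall>b\<in>set vs. 0 < b" "0 < c" "0 < d" "c < d"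
      "real c + cf_fin us = real d + cf_fin vs" for c d us vs
  proof -
    have "real c + 1 \<le> real d"
      using that by linarith
    then have "d = Suc c" "cf_fin us = 1" "cf_fin vs = 0"
      using that cf_fin_bounds[OF that(1)] cf_fin_bounds[OF that(2)] by linarith+
    then have "d = Suc c" "us = [1]" "vs = []"
      using cf_fin_eq_1 cf_fin_eq_0_iff that by auto
    then show ?thesis
      using that by (simp add: qm_list_Cons)
  qed
  have "0 < real a + cf_fin as" "0 < real b + cf_fin cs"
    using cf_fin_bounds[OF pos(1)] cf_fin_bounds[OF pos(2)] pos(3,4) by linarith+
  then have eq: "real a + cf_fin as = real b + cf_fin cs"
    using Cons.prems bs by (simp add: field_simps)
  consider "a < b" | "b < a" | "a = b"
    by linarith
  then show ?case
  proof cases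
    case 3
    then have "qm_list as = qm_list cs"
      using Cons.IH[OF pos(1,2)] eq by simp
    then show ?thesis
      using 3 pos bs by (simp add: qm_list_Cons)
  qed (use key[of as cs a b] key[of cs as b a] pos eq bs in simp_all)
qed

lemma cf_fin_Rats:
  "cf_fin as \<in> \<rat>"
  by (induction as) auto

lemma Rats_cf_fin:
  assumes "x \<in> \<rat>" "0 \<le> x" "x \<le> 1"
  shows "\<exists>as. (\<forall>a\<in>set as. 0 < a) \<and> x = cf_fin as"
proof -
  have euclid: "\<exists>as. (\<forall>a\<in>set as. 0 < a) \<and> real p / real q = cf_fin as" if "p \<le> q" "0 < q" for p q :: nat
    using that
  proof (induction p arbitrary: q rule: less_induct)
    case (less p)
    show ?case
    proof (cases "p = 0")
      case True
      then show ?thesis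
        by (intro exI[of _ "[]"]) simp
    next
      case False
      then have "q mod p < p"
        by simp
      then obtain as where as: "\<forall>a\<in>set as. 0 < a" "real (q mod p) / real p = cf_fin as"
        using less.IH[of "q mod p" p] False by auto
      have "real q = real (q div p) * real p + real (q mod p)"
        by (metis div_mult_mod_eq of_nat_add of_nat_mult)
      then have "real p / real q = 1 / (real (q div p) + cf_fin as)"
        using False by (simp add: as(2)[symmetric] field_simps)
      then show ?thesis
        using as False less.prems by (intro exI[of _ "q div p # as"]) (auto simp: div_greater_zero_iff)
    qed
  qed
  obtain m n :: nat where "n \<noteq> 0" "\<bar>x\<bar> = real m / real n"
    using Rats_abs_nat_div_natE[OF assms(1)] by metis
  then have "x = real m / real n" "m \<le> n" "0 < n"
    using assms by (auto simp: divide_le_eq_1)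
  then show ?thesis
    using euclid[of m n] by simp
qed

lemma question_mark_cf_fin:
  assumes "\<forall>a\<in>set as. 0 < a"
  shows "question_mark (cf_fin as) = qm_list as"
proof -
  have "(THE y. \<exists>bs. (\<forall>a\<in>set bs. 0 < a) \<and> cf_fin as = cf_fin bs \<and> y = qm_list bs) = qm_list as"
  proof (rule the_equality)
    show "\<exists>bs. (\<forall>a\<in>set bs. 0 < a) \<and> cf_fin as = cf_fin bs \<and> qm_list as = qm_list bs"
      using assms by blast
  next
    fix y
    assume "\<exists>bs. (\<forall>a\<in>set bs. 0 < a) \<and> cf_fin as = cf_fin bs \<and> y = qm_list bs"
    then show "y = qm_list as"
      using qm_list_cong[OF assms] by metis
  qed
  then show ?thesis
    by (simp add: question_mark_def cf_fin_Rats qm_list_def)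
qed

section \<open>Convergents as Moebius maps of the tail\<close>

abbreviation cf_tail :: "nat list \<Rightarrow> real \<Rightarrow> real" where
  "cf_tail as t \<equiv> foldr (\<lambda>a t. 1 / (real a + t)) as t"

lemma cf_fin_append: "cf_fin (as @ bs) = cf_tail as (cf_fin bs)"
  by (induction as) auto

text \<open>Each digit acts on the tail by an integer matrix of determinant -1; p'/q' is the
  preceding convergent (formally 1/0 for the empty list). The lower bound on \<open>q\<close> yields
  convergence of expansions, the upper bound controls the growth of denominators along a
  block.\<close>

lemma cf_fin_moebius:
  assumes "\<forall>a\<in>set as. 0 < a"
  obtains p q p' q' :: nat where
    "0 < q" "p \<le> q" "coprime p q" "length as \<le> q" "q \<le> prod_list (map Suc as)"
    "cf_fin as = real p / real q"
    "\<bar>real p' * real q - real p * real q'\<bar> = 1"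
    "\<And>t. 0 \<le> t \<Longrightarrow> cf_tail as t = (real p + real p' * t) / (real q + real q' * t)"
proof -
  \<comment> \<open>The extra clause on positivity of \<open>p\<close> carries the length bound: the
    new denominator a * q + p must exceed \<open>q\<close> by at least 1.\<close>
  have "\<exists>p q p' q' :: nat. 0 < q \<and> p \<le> q \<and> (as \<noteq> [] \<longrightarrow> 0 < p) \<and> coprime p q \<and>
      length as \<le> q \<and> q \<le> prod_list (map Suc as) \<and> cf_fin as = real p / real q \<and>
      \<bar>real p' * real q - real p * real q'\<bar> = 1 \<and>
      (\<forall>t\<ge>0. cf_tail as t = (real p + real p' * t) / (real q + real q' * t))"
    using assms
  proof (induction as)
    case Nil
    show ?case
      by (rule exI[of _ 0], rule exI[of _ 1], rule exI[of _ 1], rule exI[of _ 0]) auto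
  next
    case (Cons a as)
    then obtain p q p' q' :: nat where IH:
      "0 < q" "p \<le> q" "as \<noteq> [] \<longrightarrow> 0 < p" "coprime p q" "length as \<le> q"
      "q \<le> prod_list (map Suc as)" "cf_fin as = real p / real q"
      "\<bar>real p' * real q - real p * real q'\<bar> = 1"
      "\<forall>t\<ge>0. cf_tail as t = (real p + real p' * t) / (real q + real q' * t)"
      by auto
    have a: "0 < a"
      using Cons.prems by simp
    then have aq: "q \<le> a * q"
      by simp
    have len: "length (a # as) \<le> a * q + p"
    proof (cases "as = []")
      case True
      then show ?thesis
        using aq IH(1) by (simp add: Suc_le_eq)
    next
      case False
      then show ?thesis
        using aq IH(3)[rule_format, OF False] IH(5) unfolding length_Cons by linarith
    qed
    have "a * q + p \<le> Suc a * q"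
      using IH(2) by simp
    also have "\<dots> \<le> Suc a * prod_list (map Suc as)"
      using IH(6) by (intro mult_le_mono) auto
    finally have prod: "a * q + p \<le> prod_list (map Suc (a # as))"
      by simp
    have "coprime q (a * q + p)"
      using IH(4) by (metis coprime_commute coprime_iff_gcd_eq_1 gcd_add_mult mult.commute add.commute)
    moreover have "real q' * real (a * q + p) - real q * real (a * q' + p')
        = - (real p' * real q - real p * real q')"
      by (simp add: algebra_simps)
    then have "\<bar>real q' * real (a * q + p) - real q * real (a * q' + p')\<bar> = 1"
      using IH(8) by (simp only: abs_minus_cancel)
    moreover have "cf_tail (a # as) t = (real q + real q' * t) / (real (a * q + p) + real (a * q' + p') * t)"
      if "0 \<le> t" for t
    proof -
      have "0 < real q + real q' * t"
        using IH(1) that by (simp add: add_pos_nonneg)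
      then show ?thesis
        using IH(9) that by (simp add: field_simps)
    qed
    moreover have "cf_fin (a # as) = real q / real (a * q + p)"
      unfolding cf_fin.simps IH(7) using IH(1) by (simp add: field_simps)
    moreover have "0 < a * q + p" "q \<le> a * q + p"
      using aq IH(1) by linarith+
    ultimately show ?case
      using IH(1) len prod by blast
  qed
  then show ?thesis
    using that by blast
qed

lemma cf_tail_minus:
  assumes "0 < (q::nat)" "0 \<le> t" "\<bar>real p' * real q - real p * real q'\<bar> = 1"
  shows "\<bar>(real p + real p' * t) / (real q + real q' * t) - real p / real q\<bar>
    = t / (real q * (real q + real q' * t))"
proof -
  have pos: "0 < real q + real q' * t"
    using assms by (simp add: add_pos_nonneg)
  then have "(real p + real p' * t) / (real q + real q' * t) - real p / real q
      = (real p' * real q - real p * real q') * t / (real q * (real q + real q' * t))"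
    using assms(1) by (simp add: field_simps)
  then show ?thesis
    using pos assms by (simp add: abs_mult)
qed

section \<open>Infinite expansions and irrational arguments\<close>

lemma map_upt_Suc: "map a [0..<Suc n] = a 0 # map (\<lambda>k. a (Suc k)) [0..<n]"
  by (rule nth_equalityI) (auto simp: nth_Cons simp del: upt_Suc split: nat.split)

lemma is_cf_shift:
  assumes "is_cf a x" "x \<noteq> 0"
  shows "is_cf (\<lambda>k. a (Suc k)) (1 / x - real (a 0))"
proof -
  have "(\<lambda>n. cf_fin (map a [0..<Suc n])) \<longlonglongrightarrow> x"
    using assms unfolding is_cf_def by (intro LIMSEQ_Suc) auto
  then have "(\<lambda>n. 1 / cf_fin (map a [0..<Suc n]) - real (a 0)) \<longlonglongrightarrow> 1 / x - real (a 0)"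
    using assms(2) by (intro tendsto_intros)
  then show ?thesis
    using assms(1) by (simp only: is_cf_def map_upt_Suc) simp
qed

lemma is_cf_bounds:
  assumes "is_cf a x"
  shows "0 \<le> x" "x \<le> 1"
proof -
  have lim: "(\<lambda>n. cf_fin (map a [0..<n])) \<longlonglongrightarrow> x" and pos: "\<And>n. \<forall>k\<in>set (map a [0..<n]). 0 < k"
    using assms by (auto simp: is_cf_def)
  show "0 \<le> x"
    by (rule LIMSEQ_le_const[OF lim]) (use cf_fin_bounds[OF pos] in blast)
  show "x \<le> 1"
    by (rule LIMSEQ_le_const2[OF lim]) (use cf_fin_bounds[OF pos] in blast)
qed

lemma irrational_cf_step:
  fixes x :: real
  assumes "x \<notin> \<rat>"
  shows "x \<noteq> 0" "1 / x - real n \<notin> \<rat>"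
proof -
  show "x \<noteq> 0"
    using assms by auto
  show "1 / x - real n \<notin> \<rat>"
  proof
    assume "1 / x - real n \<in> \<rat>"
    then have "1 / (1 / x - real n + real n) \<in> \<rat>"
      by (intro Rats_divide Rats_add) auto
    then show False
      using assms by simp
  qed
qed

lemma is_cf_head:
  assumes "is_cf a x" "x \<notin> \<rat>"
  shows "int (a 0) = \<lfloor>1 / x\<rfloor>"
proof -
  have "is_cf (\<lambda>k. a (Suc k)) (1 / x - real (a 0))"
    using is_cf_shift irrational_cf_step assms by blast
  then have "0 \<le> 1 / x - real (a 0)" "1 / x - real (a 0) \<le> 1"
    using is_cf_bounds by blast+
  \<comment> \<open>A tail equal to 1 is the only case in which the digit is not the floor;
    irrationality rules it out.\<close>
  moreover have "1 / x - real (a 0) \<noteq> 1"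
    using irrational_cf_step(2)[OF assms(2), of "a 0"] by (metis Rats_1)
  ultimately show ?thesis
    by (intro floor_unique[symmetric]) auto
qed

lemma is_cf_unique:
  assumes "is_cf a x" "is_cf b x" "x \<notin> \<rat>"
  shows "a k = b k"
  using assms
proof (induction k arbitrary: a b x)
  case 0
  then show ?case
    using is_cf_head by (metis of_nat_eq_iff)
next
  case (Suc k)
  have "a 0 = b 0"
    using Suc.prems is_cf_head by (metis of_nat_eq_iff)
  then show ?case
    using Suc.IH[of "\<lambda>k. a (Suc k)" "1 / x - real (a 0)" "\<lambda>k. b (Suc k)"]
      is_cf_shift irrational_cf_step Suc.prems by metis
qed

text \<open>The digits are read off the orbit of the Gauss map, which stays irrational and hence
  inside (0,1). Convergence at rate 1/n suffices, and follows from the denominator of the n-th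
  convergent being at least n.\<close>

lemma is_cf_exists:
  assumes "x \<notin> \<rat>" "0 \<le> x" "x \<le> 1"
  obtains a where "is_cf a x"
proof -
  define y where "y = (\<lambda>n. ((\<lambda>x. frac (1 / x)) ^^ n) x)"
  define a where "a = (\<lambda>n. nat \<lfloor>1 / y n\<rfloor>)"
  have y_Suc: "y (Suc n) = frac (1 / y n)" for n
    by (simp add: y_def)
  have y: "y n \<notin> \<rat> \<and> 0 < y n \<and> y n < 1" for n
  proof (induction n)
    case 0
    have "x \<noteq> 0" "x \<noteq> 1"
      using assms(1) by auto
    then show ?case
      using assms by (simp add: y_def)
  next
    case (Suc n)
    have "frac (1 / y n) \<notin> \<rat>"
    proof
      assume "frac (1 / y n) \<in> \<rat>"
      then have "1 / (frac (1 / y n) + of_int \<lfloor>1 / y n\<rfloor>) \<in> \<rat>"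
        by (intro Rats_divide Rats_add) auto
      then show False
        using Suc by (simp add: frac_def)
    qed
    then show ?case
      using frac_ge_0[of "1 / y n"] frac_lt_1[of "1 / y n"] unfolding y_Suc
      by (metis Rats_0 order_le_less)
  qed
  have a_pos: "0 < a n" and y_eq: "y n = 1 / (real (a n) + y (Suc n))" for n
  proof -
    have "1 \<le> 1 / y n"
      using y[of n] by simp
    then have floor: "1 \<le> \<lfloor>1 / y n\<rfloor>"
      by linarith
    then show "0 < a n"
      by (simp add: a_def)
    have "real (a n) + y (Suc n) = 1 / y n"
      using floor by (simp add: a_def y_Suc frac_def del: one_le_floor)
    then show "y n = 1 / (real (a n) + y (Suc n))"
      by simp
  qed
  have x_eq: "x = cf_tail (map a [0..<n]) (y n)" for n
  proof (induction n)
    case (Suc n)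
    then show ?case
      using y_eq[of n] by simp
  qed (simp add: y_def)
  have bound: "\<bar>cf_fin (map a [0..<n]) - x\<bar> \<le> 1 / real n" if "0 < n" for n
  proof -
    have pos: "\<forall>k\<in>set (map a [0..<n]). 0 < k"
      using a_pos by auto
    obtain p q p' q' :: nat where m:
      "0 < q" "length (map a [0..<n]) \<le> q" "cf_fin (map a [0..<n]) = real p / real q"
      "\<bar>real p' * real q - real p * real q'\<bar> = 1"
      "\<And>t. 0 \<le> t \<Longrightarrow> cf_tail (map a [0..<n]) t = (real p + real p' * t) / (real q + real q' * t)"
      by (rule cf_fin_moebius[OF pos]) blast
    have y01: "0 \<le> y n" "y n \<le> 1"
      using y[of n] by auto
    have "\<bar>cf_fin (map a [0..<n]) - x\<bar> = y n / (real q * (real q + real q' * y n))"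
      using cf_tail_minus[OF m(1) y01(1) m(4)] m(5)[OF y01(1)] x_eq[of n] m(3)
      by (simp add: abs_minus_commute)
    also have "\<dots> \<le> 1 / (real q * 1)"
      using m(1) y01 by (intro frac_le mult_left_mono) (auto intro: add_increasing2)
    also have "\<dots> \<le> 1 / real n"
      using m(1,2) that by (auto intro: frac_le)
    finally show ?thesis .
  qed
  have "(\<lambda>n. cf_fin (map a [0..<n])) \<longlonglongrightarrow> x"
  proof (rule LIM_zero_cancel[OF tendsto_0_le[OF lim_1_over_n, where K = 1]])
    show "\<forall>\<^sub>F n in sequentially. norm (cf_fin (map a [0..<n]) - x) \<le> norm (1 / real n) * 1"
      using eventually_gt_at_top[of 0] by eventually_elim (use bound in simp)
  qed
  then show ?thesis
    using a_pos that by (auto simp: is_cf_def)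
qed

text \<open>Partial sums of the series are values of \<open>qm_list\<close> on prefixes, so
  identities for finite lists pass to irrational arguments by taking limits.\<close>

lemma question_mark_irrational:
  assumes "is_cf a x" "x \<notin> \<rat>"
  shows "(\<lambda>n. qm_list (map a [0..<n])) \<longlonglongrightarrow> question_mark x"
proof -
  define f where "f = (\<lambda>k. (-1) ^ k / (2::real) ^ ((\<Sum>j\<le>k. a j) - 1))"
  have pos: "0 < a j" for j
    using assms(1) by (simp add: is_cf_def)
  have "norm (f k) \<le> (1 / 2) ^ k" for k
  proof -
    have "Suc k \<le> (\<Sum>j\<le>k. a j)"
      using sum_mono[of "{..k}" "\<lambda>_. 1" a] pos by (simp add: Suc_leI)
    then have "(2::real) ^ k \<le> 2 ^ ((\<Sum>j\<le>k. a j) - 1)"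
      by (intro power_increasing) auto
    then show ?thesis
      by (simp add: f_def norm_divide norm_power power_divide frac_le)
  qed
  then have sums: "f sums suminf f"
    by (intro summable_sums summable_comparison_test'[OF summable_geometric[of "1 / 2"]]) auto
  have "question_mark x = (THE y. \<exists>a. is_cf a x \<and> (\<lambda>k. (-1) ^ k / 2 ^ ((\<Sum>j\<le>k. a j) - 1)) sums y)"
    using assms(2) by (simp add: question_mark_def)
  also have "\<dots> = suminf f"
  proof (rule the_equality)
    show "\<exists>a. is_cf a x \<and> (\<lambda>k. (-1) ^ k / 2 ^ ((\<Sum>j\<le>k. a j) - 1)) sums suminf f"
      using assms(1) sums unfolding f_def by blast
  next
    fix y :: real
    assume "\<exists>a. is_cf a x \<and> (\<lambda>k. (-1) ^ k / 2 ^ ((\<Sum>j\<le>k. a j) - 1)) sums y"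
    then obtain b where b: "is_cf b x" "(\<lambda>k. (-1) ^ k / 2 ^ ((\<Sum>j\<le>k. b j) - 1)) sums y"
      by blast
    have "b = a"
      using is_cf_unique[OF b(1) assms] by blast
    then show "y = suminf f"
      using b(2) sums_unique unfolding f_def by blast
  qed
  finally have "(\<lambda>n. \<Sum>k<n. f k) \<longlonglongrightarrow> question_mark x"
    using sums by (simp add: sums_def)
  moreover have "qm_list (map a [0..<n]) = (\<Sum>k<n. f k)" for n
  proof -
    have "sum_list (take (Suc k) (map a [0..<n])) = (\<Sum>j\<le>k. a j)" if "k < n" for k
      using that by (simp add: take_map interv_sum_list_conv_sum_set_nat lessThan_Suc_atMost atLeast0LessThan del: upt_Suc)
    then show ?thesis
      by (simp add: qm_list_def f_def)
  qed
  ultimately show ?thesis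
    by simp
qed

section \<open>Functional equations and behaviour at the end points\<close>

lemma question_mark_0 [simp]: "question_mark 0 = 0"
  using question_mark_cf_fin[of "[]"] by simp

lemma question_mark_bounds:
  assumes "0 \<le> x" "x \<le> 1"
  shows "0 \<le> question_mark x" "question_mark x \<le> 1"
proof -
  have "0 \<le> question_mark x \<and> question_mark x \<le> 1"
  proof (cases "x \<in> \<rat>")
    case True
    then show ?thesis
      using Rats_cf_fin[OF True assms] question_mark_cf_fin qm_list_bounds by metis
  next
    case False
    obtain a where a: "is_cf a x"
      using is_cf_exists[OF False assms] .
    have pos: "\<forall>k\<in>set (map a [0..<n]). 0 < k" for n
      using a by (auto simp: is_cf_def)
    note lim = question_mark_irrational[OF a False]
    show ?thesis
      using qm_list_bounds[OF pos]
      by (intro conjI LIMSEQ_le_const[OF lim] LIMSEQ_le_const2[OF lim]) blast+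
  qed
  then show "0 \<le> question_mark x" "question_mark x \<le> 1"
    by auto
qed

text \<open>The one place where the recursion is transferred to all of [0,1]. The halving and
  reflection laws and the estimate near 0 rest on it without a further split into rational and
  irrational arguments.\<close>

lemma question_mark_cf_step:
  assumes "0 \<le> x" "x \<le> 1" "0 < a"
  shows "question_mark (1 / (real a + x)) = 2 / 2 ^ a - question_mark x / 2 ^ a"
proof (cases "x \<in> \<rat>")
  case True
  then obtain as where as: "\<forall>a\<in>set as. 0 < a" "x = cf_fin as"
    using Rats_cf_fin assms by blast
  then show ?thesis
    using question_mark_cf_fin[of "a # as"] question_mark_cf_fin[of as] assms(3)
    by (simp add: qm_list_Cons)
next
  case False
  obtain b where b: "is_cf b x"
    using is_cf_exists[OF False assms(1,2)] .
  have bpos: "0 < b j" for j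
    using b by (simp add: is_cf_def)
  have limb: "(\<lambda>n. cf_fin (map b [0..<n])) \<longlonglongrightarrow> x"
    using b by (simp add: is_cf_def)
  define c where "c = case_nat a b"
  have c: "map c [0..<Suc n] = a # map b [0..<n]" for n
    unfolding map_upt_Suc by (simp add: c_def)
  have ax: "real a + x \<noteq> 0"
    using assms by linarith
  have irr: "1 / (real a + x) \<notin> \<rat>"
  proof
    assume "1 / (real a + x) \<in> \<rat>"
    then have "1 / (1 / (real a + x)) - real a \<in> \<rat>"
      by (intro Rats_divide[of 1 "1 / (real a + x)"] Rats_diff Rats_1 Rats_of_nat)
    then show False
      using False by simp
  qed
  have "(\<lambda>n. cf_fin (map c [0..<Suc n])) \<longlonglongrightarrow> 1 / (real a + x)"
    unfolding c cf_fin.simps using ax by (intro tendsto_intros limb)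
  then have "(\<lambda>n. cf_fin (map c [0..<n])) \<longlonglongrightarrow> 1 / (real a + x)"
    by (rule LIMSEQ_imp_Suc)
  then have "is_cf c (1 / (real a + x))"
    using assms(3) bpos by (auto simp: is_cf_def c_def split: nat.split)
  from LIMSEQ_Suc[OF question_mark_irrational[OF this irr]]
  have "(\<lambda>n. qm_list (a # map b [0..<n])) \<longlonglongrightarrow> question_mark (1 / (real a + x))"
    by (simp only: c)
  moreover have "qm_list (a # map b [0..<n]) = 2 / 2 ^ a - qm_list (map b [0..<n]) / 2 ^ a" for n
    using bpos assms(3) by (intro qm_list_Cons) auto
  moreover have "(\<lambda>n. 2 / 2 ^ a - qm_list (map b [0..<n]) / 2 ^ a)
      \<longlonglongrightarrow> 2 / 2 ^ a - question_mark x / 2 ^ a"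
    by (intro tendsto_intros question_mark_irrational[OF b False]) auto
  ultimately show ?thesis
    by (simp add: LIMSEQ_unique)
qed

lemma cf_step_exists:
  fixes x :: real
  assumes "0 < x" "x \<le> 1"
  obtains a t where "0 < a" "0 \<le> t" "t \<le> 1" "x = 1 / (real a + t)"
proof -
  have "1 \<le> 1 / x"
    using assms by simp
  then have f: "1 \<le> \<lfloor>1 / x\<rfloor>"
    by linarith
  show ?thesis
  proof (rule that)
    show "0 < nat \<lfloor>1 / x\<rfloor>"
      using f by simp
    have "real (nat \<lfloor>1 / x\<rfloor>) + frac (1 / x) = 1 / x"
      using f by (simp add: frac_def del: one_le_floor)
    then show "x = 1 / (real (nat \<lfloor>1 / x\<rfloor>) + frac (1 / x))"
      by simp
  qed (auto intro: less_imp_le frac_lt_1)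
qed

text \<open>The map x/(1+x) adds 1 to 1/x, so it only raises the first digit by 1.\<close>

lemma question_mark_half:
  assumes "0 \<le> x" "x \<le> 1"
  shows "question_mark (x / (1 + x)) = question_mark x / 2"
proof (cases "x = 0")
  case False
  then obtain a t where t: "0 < a" "0 \<le> t" "t \<le> 1" "x = 1 / (real a + t)"
    using cf_step_exists[of x] assms by auto
  have "x / (1 + x) = 1 / (real (Suc a) + t)"
    using t(1,2) unfolding t(4) by (simp add: divide_simps)
  then have "question_mark (x / (1 + x)) = 2 / 2 ^ Suc a - question_mark t / 2 ^ Suc a"
    using question_mark_cf_step[of t "Suc a"] t(2,3) by simp
  also have "\<dots> = question_mark x / 2"
    unfolding t(4) question_mark_cf_step[OF t(2,3,1)] by (simp add: diff_divide_distrib)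
  finally show ?thesis .
qed simp

text \<open>For x >= 1/2 the first digit can be taken as 1: x = 1/(1+t) and 1 - x = t/(1+t), which
  the halving law evaluates. The other half follows by exchanging x and 1 - x.\<close>

lemma question_mark_reflect:
  assumes "0 \<le> x" "x \<le> 1"
  shows "question_mark (1 - x) = 1 - question_mark x"
proof -
  have upper: "question_mark (1 - x) = 1 - question_mark x" if "1 / 2 \<le> x" "x \<le> 1" for x :: real
  proof -
    define t where "t = 1 / x - 1"
    have t: "0 \<le> t" "t \<le> 1" "x = 1 / (real 1 + t)" "1 - x = t / (1 + t)"
      using that by (auto simp: t_def field_simps)
    have "question_mark x = 1 - question_mark t / 2"
      unfolding t(3) using question_mark_cf_step[OF t(1,2), of 1] by simp
    then show ?thesis
      unfolding t(4) question_mark_half[OF t(1,2)] by simp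
  qed
  show ?thesis
    using upper[of x] upper[of "1 - x"] assms by (cases "1 / 2 \<le> x") auto
qed

lemma question_mark_1 [simp]: "question_mark 1 = 1"
  using question_mark_reflect[of 0] by simp

text \<open>With first digit \<open>a\<close> the value is (2 - ?(t)) / 2^a. One factor 2 of the
  constant 4 bounds this numerator, the other pays for replacing \<open>a\<close> by 1/x <= a +
  1.\<close>

lemma question_mark_near_0:
  assumes "0 < x" "x \<le> 1"
  shows "0 < question_mark x" "question_mark x \<le> 4 * 2 powr (- (1 / x))"
proof -
  obtain a t where t: "0 < a" "0 \<le> t" "t \<le> 1" "x = 1 / (real a + t)"
    using cf_step_exists[OF assms] by blast
  have b: "0 \<le> question_mark t" "question_mark t \<le> 1"
    using question_mark_bounds t(2,3) by auto
  have eq: "question_mark x = (2 - question_mark t) / 2 ^ a"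
    unfolding t(4) question_mark_cf_step[OF t(2,3,1)] by (simp add: diff_divide_distrib)
  show "0 < question_mark x"
    unfolding eq using b by simp
  have "question_mark x \<le> 2 / 2 ^ a"
    unfolding eq using b by (intro divide_right_mono) auto
  also have "\<dots> = 4 * 2 powr (- (real a + 1))"
    by (simp add: powr_diff powr_realpow powr_minus divide_simps)
  also have "\<dots> \<le> 4 * 2 powr (- (1 / x))"
    unfolding t(4) using t(3) by simp
  finally show "question_mark x \<le> 4 * 2 powr (- (1 / x))" .
qed

lemma question_mark_pos_less_1:
  assumes "0 < x" "x < 1"
  shows "0 < question_mark x" "question_mark x < 1"
  using question_mark_near_0(1)[of x] question_mark_near_0(1)[of "1 - x"] question_mark_reflect[of x] assms
  by auto

section \<open>Stern--Brocot intervals\<close>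

text \<open>
  The intervals $[a/b, c/d]$ of the \<open>m\<close>-th level of the Stern--Brocot subdivision of $[0,1]$; the
  question mark function maps them to the dyadic intervals of length $2^{-m}$.
\<close>

inductive farey_interval :: "nat \<Rightarrow> nat \<Rightarrow> nat \<Rightarrow> nat \<Rightarrow> nat \<Rightarrow> bool" where
  root: "farey_interval 0 1 1 1 0"
| left: "farey_interval a b c d m \<Longrightarrow> farey_interval a b (a + c) (b + d) (Suc m)"
| right: "farey_interval a b c d m \<Longrightarrow> farey_interval (a + c) (b + d) c d (Suc m)"

lemma farey_interval_props:
  assumes "farey_interval a b c d m"
  shows "0 < b \<and> 0 < d \<and> b * c = a * d + 1 \<and> m + 2 \<le> b + d \<and> b \<le> 2 ^ m \<and> d \<le> 2 ^ m"
  using assms by induction (auto simp: algebra_simps)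

text \<open>Weighting numerators and denominators separately sends t = 1/2 to the mediant, so the
  subdivision becomes bisection of the parameter. The left child is reached by t/(1+t), which maps
  [0,1] onto [0,1/2] and halves the function.\<close>

lemma question_mark_farey:
  assumes "farey_interval a b c d m" "0 \<le> t" "t \<le> 1"
  shows "question_mark ((real a * (1 - t) + real c * t) / (real b * (1 - t) + real d * t))
    = question_mark (real a / real b) + question_mark t / 2 ^ m"
  using assms
proof (induction arbitrary: t)
  case root
  then show ?case
    by simp
next
  case (left a b c d m)
  define s where "s = t / (1 + t)"
  have s: "0 \<le> s" "s \<le> 1" "question_mark s = question_mark t / 2"
    using left.prems question_mark_half[of t] by (auto simp: s_def divide_simps)
  have scale: "real u * (1 - s) + real v * s = (real u * (1 - t) + real (u + v) * t) / (1 + t)" for u v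
  proof -
    have "1 - s = 1 / (1 + t)"
      using left.prems by (simp add: s_def field_simps)
    then show ?thesis
      unfolding s_def by (simp only: times_divide_eq_right add_divide_distrib[symmetric])
        (simp add: algebra_simps)
  qed
  have "question_mark ((real a * (1 - s) + real c * s) / (real b * (1 - s) + real d * s))
      = question_mark ((real a * (1 - t) + real (a + c) * t) / (real b * (1 - t) + real (b + d) * t))"
    unfolding scale using left.prems by simp
  then show ?case
    using left.IH[OF s(1,2)] s(3) by simp
next
  case (right a b c d m)
  have key: "question_mark ((real (a + c) * (1 - t) + real c * t) / (real (b + d) * (1 - t) + real d * t))
      = question_mark (real a / real b) + (1 + question_mark t) / 2 / 2 ^ m"
    if "0 \<le> t" "t \<le> 1" for t
  proof -
    \<comment> \<open>This is 1/(2-t), the conjugate of t/(1+t) under reflection; it maps [0,1] onto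
      [1/2,1].\<close>
    define s where "s = 1 - (1 - t) / (1 + (1 - t))"
    have "0 \<le> (1 - t) / (1 + (1 - t))" "(1 - t) / (1 + (1 - t)) \<le> 1"
      using that by auto
    then have s: "0 \<le> s" "s \<le> 1" "question_mark s = (1 + question_mark t) / 2"
      using that question_mark_half[of "1 - t"] question_mark_reflect[of t]
        question_mark_reflect[of "(1 - t) / (1 + (1 - t))"]
      by (auto simp: s_def field_simps)
    have scale: "real u * (1 - s) + real v * s = (real (u + v) * (1 - t) + real v * t) / (2 - t)" for u v
    proof -
      have s1: "1 - s = (1 - t) / (2 - t)" and s2: "s = 1 / (2 - t)"
        using that by (simp_all add: s_def field_simps)
      show ?thesis
        unfolding s1 unfolding s2 by (simp only: times_divide_eq_right add_divide_distrib[symmetric])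
          (simp add: algebra_simps)
    qed
    have "question_mark ((real a * (1 - s) + real c * s) / (real b * (1 - s) + real d * s))
        = question_mark ((real (a + c) * (1 - t) + real c * t) / (real (b + d) * (1 - t) + real d * t))"
      unfolding scale using that by simp
    then show ?thesis
      using right.IH[OF s(1,2)] s(3) by simp
  qed
  \<comment> \<open>The instance at 0 evaluates the function at the mediant, the new left end
    point.\<close>
  show ?case
    using key[OF right.prems] key[of 0] by (simp add: add_divide_distrib)
qed

lemma question_mark_mediant:
  assumes "farey_interval a b c d m"
  shows "question_mark (real (a + c) / real (b + d)) = question_mark (real a / real b) + 1 / 2 ^ Suc m"
  using question_mark_farey[OF farey_interval.left[OF assms], of 1] by simp

lemma question_mark_farey_dyadic:
  assumes "farey_interval a b c d m"
  shows "\<exists>P::int. 2 ^ m * question_mark (real a / real b) = of_int P"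
  using assms
proof induction
  case root
  then show ?case
    by (intro exI[of _ 0]) simp
next
  case (left a b c d m)
  then obtain P :: int where "2 ^ m * question_mark (real a / real b) = of_int P"
    by blast
  then show ?case
    by (intro exI[of _ "2 * P"]) simp
next
  case (right a b c d m)
  then obtain P :: int where "2 ^ m * question_mark (real a / real b) = of_int P"
    by blast
  then show ?case
    using question_mark_mediant[OF right.hyps] by (intro exI[of _ "2 * P + 1"]) (simp add: field_simps)
qed

section \<open>Flatness at a reduced fraction\<close>

text \<open>Subtractive Euclid on coordinates: \<open>u\<close> and \<open>v\<close> express the
  fraction as (a*u + c*v)/(b*u + d*v) in the current interval, and passing to a child subtracts the
  smaller from the larger. Coprimality makes the descent stop at u = v = 1, the mediant. In the root
  interval the coordinates are q - p and p.\<close>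

lemma coprime_is_mediant:
  assumes "0 < p" "p < q" "coprime p q"
  obtains a b c d m where "farey_interval a b c d m" "p = a + c" "q = b + d"
proof -
  have descent: "\<exists>a' b' c' d' m'. farey_interval a' b' c' d' m' \<and>
      a * u + c * v = a' + c' \<and> b * u + d * v = b' + d'"
    if "farey_interval a b c d m" "0 < u" "0 < v" "coprime u v" for a b c d m u v
    using that
  proof (induction "u + v" arbitrary: a b c d m u v rule: less_induct)
    case less
    consider "u = v" | "v < u" | "u < v"
      by linarith
    then show ?case
    proof cases
      case 1
      then have "u = 1" "v = 1"
        using less.prems by auto
      then show ?thesis
        using less.prems(1) unfolding \<open>u = 1\<close> \<open>v = 1\<close> mult_1_right by blast
    next
      case 2
      have "coprime (u - v) v"
        using less.prems 2 by (metis coprime_iff_gcd_eq_1 gcd_diff1_nat less_imp_le_nat)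
      then have "\<exists>a' b' c' d' m'. farey_interval a' b' c' d' m' \<and>
          a * (u - v) + (a + c) * v = a' + c' \<and> b * (u - v) + (b + d) * v = b' + d'"
        using 2 less.prems by (intro less.hyps[OF _ farey_interval.left]) auto
      moreover have "x * (u - v) + (x + y) * v = x * u + y * v" for x y
        using less_imp_Suc_add[OF 2] by (auto simp: algebra_simps)
      ultimately show ?thesis
        by simp
    next
      case 3
      have "coprime u (v - u)"
        using less.prems 3 by (metis coprime_commute coprime_iff_gcd_eq_1 gcd_diff1_nat less_imp_le_nat)
      then have "\<exists>a' b' c' d' m'. farey_interval a' b' c' d' m' \<and>
          (a + c) * u + c * (v - u) = a' + c' \<and> (b + d) * u + d * (v - u) = b' + d'"
        using 3 less.prems by (intro less.hyps[OF _ farey_interval.right]) auto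
      moreover have "(x + y) * u + y * (v - u) = x * u + y * v" for x y
        using less_imp_Suc_add[OF 3] by (auto simp: algebra_simps)
      ultimately show ?thesis
        by simp
    qed
  qed
  have "coprime (q - p) p"
    using assms by (metis coprime_commute coprime_iff_gcd_eq_1 gcd_diff1_nat less_imp_le_nat)
  then have "\<exists>a' b' c' d' m'. farey_interval a' b' c' d' m' \<and>
      0 * (q - p) + 1 * p = a' + c' \<and> 1 * (q - p) + 1 * p = b' + d'"
    using assms by (intro descent[OF farey_interval.root]) auto
  then show ?thesis
    using that assms by auto
qed

text \<open>In the application \<open>e\<close> is 1 or -1, so both sides of p/q are treated at
  once. The point with parameter t is displaced from p/q by e*t/(q*(q*(1-t)+d*t)); solving for t
  gives the witness, whose denominator \<open>D\<close> is at least 1 because d <= q.\<close>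

lemma farey_parameter:
  fixes p q c d \<delta> e :: real
  assumes "0 < q" "0 < d" "d \<le> q" "c * q - p * d = e" "0 < \<delta>" "\<delta> \<le> 1 / q\<^sup>2"
  obtains t where "0 < t" "t \<le> 1" "1 / (q\<^sup>2 * \<delta>) \<le> 1 / t"
    "p / q + e * \<delta> = (p * (1 - t) + c * t) / (q * (1 - t) + d * t)"
proof -
  define D where "D = 1 + \<delta> * q * (q - d)"
  define t where "t = \<delta> * q\<^sup>2 / D"
  have D: "1 \<le> D"
    using assms by (simp add: D_def)
  have "\<delta> * q * d \<le> \<delta> * q * q"
    using assms by (intro mult_left_mono) auto
  also have "\<dots> \<le> 1"
    using assms by (simp add: field_simps power2_eq_square)
  finally have t1: "\<delta> * q\<^sup>2 \<le> D"
    by (simp add: D_def algebra_simps power2_eq_square)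
  have e: "p / q + e * \<delta> = (p * (1 - t) + c * t) / (q * (1 - t) + d * t)"
  proof -
    have den: "q * (1 - t) + d * t = q / D"
      using D by (simp add: t_def field_simps) (simp add: D_def algebra_simps power2_eq_square)
    have num: "p * (1 - t) + c * t = (p + e * \<delta> * q) / D"
      using D by (simp add: t_def field_simps) (simp add: D_def assms(4)[symmetric] algebra_simps power2_eq_square)
    show ?thesis
      unfolding den num using D assms(1) by (simp add: field_simps)
  qed
  show ?thesis
  proof (rule that[OF _ _ _ e])
    show "0 < t" "t \<le> 1"
      using D t1 assms by (auto simp: t_def)
    have "1 / t = D * (1 / (q\<^sup>2 * \<delta>))"
      by (simp add: t_def)
    also have "\<dots> \<ge> 1 * (1 / (q\<^sup>2 * \<delta>))"
      using D assms by (intro mult_right_mono) auto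
    finally show "1 / (q\<^sup>2 * \<delta>) \<le> 1 / t"
      by simp
  qed
qed

text \<open>For a convergent p/q of z this is the next partial quotient up to a bounded error. At z
  = p/q division by zero makes it 0.\<close>

definition approx_quality :: "real \<Rightarrow> nat \<Rightarrow> nat \<Rightarrow> real" where
  "approx_quality z p q = 1 / ((real q)\<^sup>2 * \<bar>z - real p / real q\<bar>)"

text \<open>
  Near a rational \<open>p/q\<close> the question mark function behaves like
  $t \mapsto 2^{-m} \cdot 2^{-1/(q^2 t)}$ on both sides, because it maps the two adjacent
  Stern--Brocot intervals of level \<open>m\<close> self-similarly and satisfies $?(t) \le 4 \cdot 2^{-1/t}$.
\<close>

definition has_level :: "nat \<Rightarrow> nat \<Rightarrow> nat \<Rightarrow> bool" where
  "has_level p q m \<longleftrightarrow> 0 < p \<and> p < q \<and> 0 < m \<and> m < q \<and> q \<le> 2 ^ m \<and>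
     (\<exists>P::int. odd P \<and> 2 ^ m * question_mark (real p / real q) = of_int P) \<and>
     (\<forall>z. z \<noteq> real p / real q \<longrightarrow> \<bar>z - real p / real q\<bar> \<le> 1 / (real q)\<^sup>2 \<longrightarrow>
       0 < \<bar>question_mark z - question_mark (real p / real q)\<bar> \<and>
       \<bar>question_mark z - question_mark (real p / real q)\<bar>
         \<le> 4 / 2 ^ m * 2 powr (- approx_quality z p q))"

text \<open>The fraction enters as the mediant of an interval of level n, so its image is the
  midpoint of a dyadic interval: hence level n + 1 and an odd numerator.\<close>

lemma has_level_exists:
  assumes "0 < p" "p < q" "coprime p q"
  obtains m where "has_level p q m"
proof -
  obtain a b c d n where F: "farey_interval a b c d n" and p: "p = a + c" and q: "q = b + d"
    using coprime_is_mediant[OF assms] .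
  note props = farey_interval_props[OF F]
  have L: "farey_interval a b p q (Suc n)" and R: "farey_interval p q c d (Suc n)"
    using farey_interval.left[OF F] farey_interval.right[OF F] p q by auto
  have mid: "question_mark (real p / real q) = question_mark (real a / real b) + 1 / 2 ^ Suc n"
    using question_mark_mediant[OF F] p q by simp
  have "real (b * c) = real (a * d + 1)"
    using props by simp
  then have det0: "real b * real c = real a * real d + 1"
    by simp
  have "0 < \<bar>question_mark z - question_mark (real p / real q)\<bar> \<and>
       \<bar>question_mark z - question_mark (real p / real q)\<bar> \<le> 4 / 2 ^ Suc n * 2 powr (- approx_quality z p q)"
    if z: "z \<noteq> real p / real q" "\<bar>z - real p / real q\<bar> \<le> 1 / (real q)\<^sup>2" for z
  proof -
    have "\<exists>t. 0 < t \<and> t \<le> 1 \<and> approx_quality z p q \<le> 1 / t \<and>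
        \<bar>question_mark z - question_mark (real p / real q)\<bar> = question_mark t / 2 ^ Suc n"
    proof (cases "real p / real q < z")
      case True
      have det: "real c * real q - real p * real d = 1"
        using det0 by (simp add: p q algebra_simps)
      obtain t where t: "0 < t" "t \<le> 1" "1 / ((real q)\<^sup>2 * (z - real p / real q)) \<le> 1 / t"
        "real p / real q + 1 * (z - real p / real q)
          = (real p * (1 - t) + real c * t) / (real q * (1 - t) + real d * t)"
        by (rule farey_parameter[of "real q" "real d" "real c" "real p" 1 "z - real p / real q"])
           (use True z props det q in auto)
      have "question_mark z = question_mark (real p / real q) + question_mark t / 2 ^ Suc n"
        using question_mark_farey[OF R, of t] t by simp
      then show ?thesis
        using t True question_mark_bounds(1)[of t] by (intro exI[of _ t]) (auto simp: approx_quality_def)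
    next
      case False
      have det: "real a * real q - real p * real b = -1"
        using det0 by (simp add: p q algebra_simps)
      obtain t where t: "0 < t" "t \<le> 1" "1 / ((real q)\<^sup>2 * (real p / real q - z)) \<le> 1 / t"
        "real p / real q + (-1) * (real p / real q - z)
          = (real p * (1 - t) + real a * t) / (real q * (1 - t) + real b * t)"
        by (rule farey_parameter[of "real q" "real b" "real a" "real p" "-1" "real p / real q - z"])
           (use False z props det q in auto)
      \<comment> \<open>On the left of p/q the parameter t runs from p/q towards a/b, against the
        orientation of the interval; hence 1 - t and the reflection law.\<close>
      have z_eq: "z = (real a * (1 - (1 - t)) + real p * (1 - t)) / (real b * (1 - (1 - t)) + real q * (1 - t))"
        using t(4) by (simp add: add.commute)
      have "question_mark z = question_mark (real a / real b) + question_mark (1 - t) / 2 ^ Suc n"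
        unfolding z_eq using question_mark_farey[OF L, of "1 - t"] t(1,2) by simp
      then have "question_mark z = question_mark (real p / real q) - question_mark t / 2 ^ Suc n"
        using question_mark_reflect[of t] t mid by (simp add: field_simps)
      then show ?thesis
        using t False question_mark_bounds(1)[of t] z(1)
        by (intro exI[of _ t]) (auto simp: approx_quality_def abs_minus_commute)
    qed
    then obtain t where t: "0 < t" "t \<le> 1" "approx_quality z p q \<le> 1 / t"
      and eq: "\<bar>question_mark z - question_mark (real p / real q)\<bar> = question_mark t / 2 ^ Suc n"
      by blast
    have "question_mark t \<le> 4 * 2 powr (- (1 / t))"
      using question_mark_near_0 t by blast
    also have "\<dots> \<le> 4 * 2 powr (- approx_quality z p q)"
      using t by simp
    finally show ?thesis
      unfolding eq using question_mark_near_0(1)[OF t(1,2)] by (simp add: field_simps)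
  qed
  moreover have "\<exists>P::int. odd P \<and> 2 ^ Suc n * question_mark (real p / real q) = of_int P"
  proof -
    obtain P :: int where "2 ^ n * question_mark (real a / real b) = of_int P"
      using question_mark_farey_dyadic[OF F] by blast
    then have "2 ^ Suc n * question_mark (real p / real q) = of_int (2 * P + 1)"
      unfolding mid by (simp add: field_simps)
    moreover have "odd (2 * P + 1)"
      by simp
    ultimately show ?thesis
      by blast
  qed
  moreover have "Suc n < q" "q \<le> 2 ^ Suc n"
    using props q by auto
  ultimately show ?thesis
    using that[of "Suc n"] assms unfolding has_level_def by blast
qed

section \<open>Rapidly approximable numbers\<close>

lemma le_2_powr: "v \<le> 2 powr v" for v :: real
proof (cases "0 \<le> v")
  case True
  define n where "n = nat \<lfloor>v\<rfloor>"
  have n: "real n \<le> v" "v < real n + 1"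
    using True by (auto simp: n_def)
  have "n + 1 \<le> 2 ^ n"
    by (simp add: Suc_leI)
  then have "real (n + 1) \<le> real (2 ^ n)"
    by (simp only: of_nat_le_iff)
  also have "\<dots> = 2 powr real n"
    by (simp add: powr_realpow)
  also have "\<dots> \<le> 2 powr v"
    using n by simp
  finally show ?thesis
    using n by simp
qed (use powr_ge_zero[of 2 v] in linarith)

text \<open>Quality falls with distance, so a whole ball obeys the bound at its radius, centre
  included. One radius can then serve two points.\<close>

lemma question_mark_near_rational:
  assumes "has_level p q m" "0 < D" "D \<le> 1 / (real q)\<^sup>2" "\<bar>z - real p / real q\<bar> \<le> D"
  shows "\<bar>question_mark z - question_mark (real p / real q)\<bar> \<le> 4 / 2 ^ m * 2 powr (- (1 / ((real q)\<^sup>2 * D)))"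
proof (cases "z = real p / real q")
  case False
  have q: "0 < real q"
    using assms(1) by (auto simp: has_level_def)
  have "\<bar>question_mark z - question_mark (real p / real q)\<bar> \<le> 4 / 2 ^ m * 2 powr (- approx_quality z p q)"
    using assms False unfolding has_level_def by (meson order_trans)
  also have "\<dots> \<le> 4 / 2 ^ m * 2 powr (- (1 / ((real q)\<^sup>2 * D)))"
    using False q assms(2,4) unfolding approx_quality_def
    by (intro mult_left_mono powr_mono le_imp_neg_le divide_left_mono mult_pos_pos) auto
  finally show ?thesis .
qed auto

text \<open>
  With $h = |z - y|$ and $\delta$ the distance from \<open>y\<close> to $r_k = p_k/q_k$, consider
  $H_{k+1} < h \le H_k$, where $H_k = 1/(20 q_k^2 m_k)$. If $\delta \le 4h$, then both points are within
  $5h$ of $r_k$, where the function is flat to order $o(h)$; otherwise both are within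
  $5\delta/4$ of $r_k$, where it varies so little that even $H_{k+1}$ is large in comparison.
\<close>

lemma question_mark_derivative_0:
  fixes p q m :: "nat \<Rightarrow> nat"
  assumes level: "\<And>k. has_level (p k) (q k) (m k)"
    and ne: "\<And>k. y \<noteq> real (p k) / real (q k)"
    and quality: "\<And>k. 5 / 4 \<le> approx_quality y (p k) (q k)"
    and q_lim: "filterlim q at_top sequentially"
    and small: "(\<lambda>k. (real (q (Suc k)))\<^sup>2 * real (m (Suc k)) / 2 ^ m k
        * 2 powr (- (4 / 5) * approx_quality y (p k) (q k))) \<longlonglongrightarrow> 0"
  shows "(question_mark has_real_derivative 0) (at y)"
  unfolding has_field_derivative_iff
proof (rule LIM_I)
  fix e :: real assume e: "0 < e"
  define r where "r = (\<lambda>k. real (p k) / real (q k))"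
  \<comment> \<open>The 20 is 5 * 4: radius 5h gives the exponent 1/(5 q^2 h) = 4v with v = 1/(20
    q^2 h), and h <= H_k says exactly v >= m_k.\<close>
  define H where "H = (\<lambda>k. 1 / (20 * (real (q k))\<^sup>2 * real (m k)))"
  define S where "S = (\<lambda>k. (real (q (Suc k)))\<^sup>2 * real (m (Suc k)) / 2 ^ m k
        * 2 powr (- (4 / 5) * approx_quality y (p k) (q k)))"
  have q1: "1 \<le> real (q k)" and m1: "1 \<le> real (m k)" and qm: "real (q k) \<le> 2 ^ m k" for k
  proof -
    have "0 < q k" "0 < m k" "q k \<le> 2 ^ m k"
      using level[of k] by (auto simp: has_level_def)
    then show "1 \<le> real (q k)" "1 \<le> real (m k)" "real (q k) \<le> 2 ^ m k"
      using of_nat_mono[of "q k" "2 ^ m k", where 'a = real] by auto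
  qed
  have q_sq: "real (q k) \<le> (real (q k))\<^sup>2" for k
    using q1[of k] by (simp add: power2_eq_square)
  have H_pos: "0 < H k" for k
    using q1[of k] m1[of k] unfolding H_def by (intro divide_pos_pos mult_pos_pos) auto
  have q_real: "filterlim (\<lambda>k. real (q k)) at_top sequentially"
    by (rule filterlim_compose[OF filterlim_real_sequentially q_lim])
  have inv_lim: "(\<lambda>k. 160 / real (q k)) \<longlonglongrightarrow> 0"
    by (rule tendsto_divide_0[OF tendsto_const filterlim_at_top_imp_at_infinity[OF q_real]])
  have "\<forall>\<^sub>F k in sequentially. 160 / real (q k) < e"
    using order_tendstoD(2)[OF inv_lim e] .
  moreover have "\<forall>\<^sub>F k in sequentially. 160 * S k < e"
    using order_tendstoD(2)[OF tendsto_mult_right_zero[OF small, of 160] e] by (simp add: S_def)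
  ultimately have "\<forall>\<^sub>F k in sequentially. 160 / real (q k) < e \<and> 160 * S k < e"
    by eventually_elim simp
  then obtain K where K: "\<And>k. K \<le> k \<Longrightarrow> 160 / real (q k) < e \<and> 160 * S k < e"
    by (auto simp: eventually_sequentially)
  have "\<bar>question_mark z - question_mark y\<bar> < e * \<bar>z - y\<bar>" if z: "z \<noteq> y" "\<bar>z - y\<bar> < H K" for z
  proof -
    define h where "h = \<bar>z - y\<bar>"
    have h: "0 < h" "h < H K"
      using z by (auto simp: h_def)
    have "\<forall>\<^sub>F k in sequentially. 160 / real (q k) < h"
      using order_tendstoD(2)[OF inv_lim h(1)] .
    then obtain N where "\<And>j. N \<le> j \<Longrightarrow> 160 / real (q j) < h"
      by (auto simp: eventually_sequentially)
    then obtain j where j: "K \<le> j" "160 / real (q j) < h"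
      using max.cobounded1 max.cobounded2 by blast
    have "H j \<le> 1 / real (q j)"
    proof -
      have "real (q j) * 1 \<le> (20 * (real (q j))\<^sup>2) * real (m j)"
        using q_sq[of j] q1[of j] m1[of j] by (intro mult_mono) linarith+
      then show ?thesis
        using q1[of j] m1[of j] unfolding H_def by (intro divide_left_mono mult_pos_pos) auto
    qed
    also have "\<dots> \<le> 160 / real (q j)"
      by (intro divide_right_mono) auto
    finally have "K \<le> j \<and> H j < h"
      using j by simp
    then have L: "K \<le> (LEAST j. K \<le> j \<and> H j < h) \<and> H (LEAST j. K \<le> j \<and> H j < h) < h"
      by (rule LeastI)
    \<comment> \<open>\<open>H\<close> need not be monotone. The least index from \<open>K\<close>
      on with H < h still gives consecutive indices with H_{k+1} < h <= H_k, since h < H_K excludes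
      \<open>K\<close> itself.\<close>
    define l where "l = (LEAST j. K \<le> j \<and> H j < h)"
    have "l \<noteq> K" "K \<le> l" "H l < h"
      using L h by (auto simp: l_def)
    then obtain k where l: "l = Suc k" "K \<le> k"
      by (cases l) auto
    have "\<not> (K \<le> k \<and> H k < h)"
      using not_less_Least[of k "\<lambda>j. K \<le> j \<and> H j < h"] l by (simp add: l_def[symmetric])
    then have hk: "h \<le> H k" "H (Suc k) < h"
      using l \<open>H l < h\<close> by auto
    define \<delta> where "\<delta> = \<bar>y - r k\<bar>"
    define w where "w = approx_quality y (p k) (q k)"
    have \<delta>: "0 < \<delta>"
      using ne[of k] by (simp add: \<delta>_def r_def)
    have w: "w = 1 / ((real (q k))\<^sup>2 * \<delta>)"
      by (simp add: w_def approx_quality_def \<delta>_def r_def)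
    have zr: "\<bar>z - r k\<bar> \<le> h + \<delta>"
      by (simp add: h_def \<delta>_def)
    have dist: "\<bar>question_mark z - question_mark y\<bar> \<le> 8 / 2 ^ m k * 2 powr (- (1 / ((real (q k))\<^sup>2 * D)))"
      if "0 < D" "D \<le> 1 / (real (q k))\<^sup>2" "h + \<delta> \<le> D" for D
    proof -
      have "\<bar>z - r k\<bar> \<le> D" "\<bar>y - r k\<bar> \<le> D"
        using that zr h(1) unfolding \<delta>_def by linarith+
      then have "\<bar>question_mark z - question_mark (r k)\<bar> \<le> 4 / 2 ^ m k * 2 powr (- (1 / ((real (q k))\<^sup>2 * D)))"
        "\<bar>question_mark y - question_mark (r k)\<bar> \<le> 4 / 2 ^ m k * 2 powr (- (1 / ((real (q k))\<^sup>2 * D)))"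
        using question_mark_near_rational[OF level[of k] that(1,2)] unfolding r_def by blast+
      then show ?thesis
        by linarith
    qed
    show ?thesis
    proof (cases "\<delta> \<le> 4 * h")
      case True
      define v where "v = 1 / (20 * (real (q k))\<^sup>2 * h)"
      have q_pos: "0 < real (q k)"
        using q1[of k] by linarith
      have "5 * h \<le> 5 * H k"
        using hk by simp
      also have "\<dots> \<le> 1 / (real (q k))\<^sup>2"
      proof -
        have "(real (q k))\<^sup>2 * 1 \<le> (4 * (real (q k))\<^sup>2) * real (m k)"
          using m1[of k] by (intro mult_mono) auto
        then have "1 / (4 * (real (q k))\<^sup>2 * real (m k)) \<le> 1 / (real (q k))\<^sup>2"
          using q_pos m1[of k] by (intro divide_left_mono mult_pos_pos) auto
        then show ?thesis
          by (simp add: H_def mult.commute)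
      qed
      finally have "\<bar>question_mark z - question_mark y\<bar>
          \<le> 8 / 2 ^ m k * 2 powr (- (1 / ((real (q k))\<^sup>2 * (5 * h))))"
        using True h by (intro dist) auto
      also have "1 / ((real (q k))\<^sup>2 * (5 * h)) = 4 * v"
        by (simp add: v_def)
      \<comment> \<open>The inserted factor equals 1 and exposes h. One of the four v pays for the
        factor v, the other three beat 2^m and leave at most 1/q.\<close>
      also have "8 / 2 ^ m k * 2 powr (- (4 * v)) = 8 / 2 ^ m k * (h * (20 * (real (q k))\<^sup>2 * v)) * 2 powr (- (4 * v))"
        using h q_pos by (simp add: v_def)
      also have "\<dots> \<le> 8 / 2 ^ m k * (h * (20 * (2 ^ m k)\<^sup>2 * 2 powr v)) * 2 powr (- (4 * v))"
        using h qm[of k] le_2_powr[of v] by (intro mult_right_mono mult_left_mono mult_mono power_mono) (auto simp: v_def)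
      also have "\<dots> = 160 * h * (2 ^ m k * (2 powr v * 2 powr (- (4 * v))))"
        by (simp add: power2_eq_square)
      also have "\<dots> = 160 * h * 2 powr (real (m k) - 3 * v)"
      proof -
        have "real (m k) - 3 * v = real (m k) + (v + - (4 * v))"
          by simp
        then show ?thesis
          by (simp only: powr_add powr_realpow)
      qed
      also have "\<dots> \<le> 160 * h * (1 / real (q k))"
      proof (rule mult_left_mono)
        have "h * real (m k) \<le> H k * real (m k)"
          using hk m1[of k] by (intro mult_right_mono) auto
        also have "\<dots> = 1 / (20 * (real (q k))\<^sup>2)"
          using m1[of k] by (simp add: H_def)
        finally have "real (m k) \<le> v"
          using h q_pos by (simp add: v_def field_simps)
        then have "2 powr (real (m k) - 3 * v) \<le> 2 powr (- real (m k))"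
          using m1[of k] by simp
        also have "\<dots> = 1 / 2 ^ m k"
          by (simp add: powr_minus powr_realpow divide_simps)
        also have "\<dots> \<le> 1 / real (q k)"
          using qm[of k] q_pos by (intro divide_left_mono) auto
        finally show "2 powr (real (m k) - 3 * v) \<le> 1 / real (q k)" .
      qed (use h in simp)
      also have "\<dots> = 160 / real (q k) * h"
        by simp
      also have "\<dots> < e * h"
        using K[OF l(2)] h by (intro mult_strict_right_mono) auto
      finally show ?thesis
        by (simp add: h_def)
    next
      case False
      have q_pos: "0 < real (q k)"
        using q1[of k] by linarith
      \<comment> \<open>This is the assumed quality of at least 5/4, rewritten.\<close>
      have "5 / 4 * \<delta> \<le> 1 / (real (q k))\<^sup>2"
        using quality[of k] q_pos \<delta> unfolding w_def[symmetric] w by (simp add: field_simps)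
      then have "\<bar>question_mark z - question_mark y\<bar>
          \<le> 8 / 2 ^ m k * 2 powr (- (1 / ((real (q k))\<^sup>2 * (5 / 4 * \<delta>))))"
        using False \<delta> by (intro dist) auto
      also have "1 / ((real (q k))\<^sup>2 * (5 / 4 * \<delta>)) = 4 / 5 * w"
        by (simp add: w)
      \<comment> \<open>The factor q^2 m at index k + 1 in \<open>S\<close> is 1/(20 H_{k+1}), and 8
        * 20 = 160.\<close>
      also have "8 / 2 ^ m k * 2 powr (- (4 / 5 * w)) = 160 * S k * H (Suc k)"
        using q1[of "Suc k"] m1[of "Suc k"] by (simp add: S_def H_def w_def)
      also have "\<dots> \<le> 160 * S k * h"
        using hk by (intro mult_left_mono) (auto simp: S_def)
      also have "\<dots> < e * h"
        using K[OF l(2)] h by (intro mult_strict_right_mono) auto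
      finally show ?thesis
        by (simp add: h_def)
    qed
  qed
  then show "\<exists>s>0. \<forall>z. z \<noteq> y \<and> norm (z - y) < s \<longrightarrow>
      norm ((question_mark z - question_mark y) / (z - y) - 0) < e"
    using H_pos[of K] by (intro exI[of _ "H K"]) (auto simp: pos_divide_less_eq)
qed

lemma has_level_image:
  assumes "has_level p q m" "y \<noteq> real p / real q" "1 \<le> approx_quality y p q"
  obtains P where "0 < P" "P < 2 ^ m" "coprime P (2 ^ m)" "question_mark y \<noteq> real P / real (2 ^ m)"
    "2 powr (approx_quality y p q - real m - 2) \<le> approx_quality (question_mark y) P (2 ^ m)"
proof -
  define r where "r = real p / real q"
  have pq: "0 < p" "p < q" "0 < m"
    using assms(1) by (auto simp: has_level_def)
  have r: "0 < question_mark r" "question_mark r < 1"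
    using pq by (auto intro!: question_mark_pos_less_1 simp: r_def)
  obtain P :: int where P: "odd P" "2 ^ m * question_mark r = of_int P"
    using assms(1) by (auto simp: has_level_def r_def)
  have "0 < real_of_int P"
    unfolding P(2)[symmetric] using r by simp
  then have P0: "0 < P"
    by simp
  have "real_of_int P < 2 ^ m"
    unfolding P(2)[symmetric] using r by simp
  then have P1: "P < 2 ^ m"
    by (metis of_int_less_iff of_int_numeral of_int_power)
  have r_eq: "question_mark r = real (nat P) / real (2 ^ m)"
    using P(2) P0 by (simp add: field_simps)
  have "\<bar>y - r\<bar> \<le> 1 / (real q)\<^sup>2"
    using assms(2,3) pq unfolding approx_quality_def r_def by (simp add: field_simps)
  then have diff: "0 < \<bar>question_mark y - question_mark r\<bar>"
    "\<bar>question_mark y - question_mark r\<bar> \<le> 4 / 2 ^ m * 2 powr (- approx_quality y p q)"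
    using assms(1,2) unfolding has_level_def r_def by blast+
  show ?thesis
  proof (rule that[of "nat P"])
    show "0 < nat P" "nat P < 2 ^ m"
      using P0 P1 by (auto simp: nat_less_iff)
    show "coprime (nat P) (2 ^ m)"
      using P(1) P0 by (simp add: coprime_power_right_iff even_nat_iff)
    show "question_mark y \<noteq> real (nat P) / real (2 ^ m)"
      using diff(1) r_eq by auto
    have "2 powr (approx_quality y p q - real m - 2)
        = 1 / ((2 ^ m)\<^sup>2 * (4 / 2 ^ m * 2 powr (- approx_quality y p q)))"
      by (simp add: powr_diff powr_add powr_minus powr_realpow power2_eq_square field_simps)
    also have "\<dots> \<le> 1 / ((2 ^ m)\<^sup>2 * \<bar>question_mark y - question_mark r\<bar>)"
      using diff by (intro divide_left_mono mult_left_mono mult_pos_pos) auto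
    also have "\<dots> = approx_quality (question_mark y) (nat P) (2 ^ m)"
      unfolding approx_quality_def r_eq by simp
    finally show "2 powr (approx_quality y p q - real m - 2) \<le> approx_quality (question_mark y) (nat P) (2 ^ m)" .
  qed
qed

section \<open>The approximation property inherited by images\<close>

text \<open>With 1/4, the product q^2 m <= q^3 at index k + 1 is at most 2^(3w/4), below the
  available 2^(4w/5). With 8 and m < q one has w >= 8m + 8, hence w - m - 2 >= m + 3 and w - m - 4
  >= w/4, the two inequalities that reproduce the property for the image.\<close>

definition rapidly_approximable :: "real \<Rightarrow> bool" where
  "rapidly_approximable y \<longleftrightarrow> 0 < y \<and> y < 1 \<and>
     (\<exists>p q :: nat \<Rightarrow> nat. filterlim q at_top sequentially \<and>
       (\<forall>k. 0 < p k \<and> p k < q k \<and> coprime (p k) (q k) \<and> y \<noteq> real (p k) / real (q k) \<and>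
         8 * real (q k) \<le> approx_quality y (p k) (q k) \<and>
         real (q (Suc k)) \<le> 2 powr (approx_quality y (p k) (q k) / 4)))"

lemma rapidly_approximable_levels:
  assumes "rapidly_approximable y"
  shows "\<exists>p q m :: nat \<Rightarrow> nat. filterlim q at_top sequentially \<and>
    (\<forall>k. has_level (p k) (q k) (m k) \<and> y \<noteq> real (p k) / real (q k) \<and>
      8 * real (q k) \<le> approx_quality y (p k) (q k) \<and>
      real (q (Suc k)) \<le> 2 powr (approx_quality y (p k) (q k) / 4))"
proof -
  obtain p q :: "nat \<Rightarrow> nat" where q_lim: "filterlim q at_top sequentially"
    and pq: "\<And>k. 0 < p k \<and> p k < q k \<and> coprime (p k) (q k) \<and> y \<noteq> real (p k) / real (q k) \<and>
         8 * real (q k) \<le> approx_quality y (p k) (q k) \<and>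
         real (q (Suc k)) \<le> 2 powr (approx_quality y (p k) (q k) / 4)"
    using assms unfolding rapidly_approximable_def by blast
  have "\<exists>m. has_level (p k) (q k) m" for k
    using has_level_exists[of "p k" "q k"] pq[of k] by blast
  then obtain m where "has_level (p k) (q k) (m k)" for k
    by metis
  then have "filterlim q at_top sequentially \<and>
    (\<forall>k. has_level (p k) (q k) (m k) \<and> y \<noteq> real (p k) / real (q k) \<and>
      8 * real (q k) \<le> approx_quality y (p k) (q k) \<and>
      real (q (Suc k)) \<le> 2 powr (approx_quality y (p k) (q k) / 4))"
    using pq q_lim by simp
  then show ?thesis
    by blast
qed

lemma rapidly_approximable_derivative_0:
  assumes "rapidly_approximable y"
  shows "(question_mark has_real_derivative 0) (at y)"
proof -
  obtain p q m :: "nat \<Rightarrow> nat" where q_lim: "filterlim q at_top sequentially"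
    and pq: "\<forall>k. has_level (p k) (q k) (m k) \<and> y \<noteq> real (p k) / real (q k) \<and>
      8 * real (q k) \<le> approx_quality y (p k) (q k) \<and>
      real (q (Suc k)) \<le> 2 powr (approx_quality y (p k) (q k) / 4)"
    using rapidly_approximable_levels[OF assms] by blast
  have level: "has_level (p k) (q k) (m k)" and ne: "y \<noteq> real (p k) / real (q k)"
    and quality: "8 * real (q k) \<le> approx_quality y (p k) (q k)"
    and q_Suc: "real (q (Suc k)) \<le> 2 powr (approx_quality y (p k) (q k) / 4)" for k
    using pq by blast+
  define w where "w = (\<lambda>k. approx_quality y (p k) (q k))"
  have q1: "1 \<le> real (q k)" and mq: "real (m k) \<le> real (q k)" for k
    using level[of k] by (auto simp: has_level_def)
  have bound: "(real (q (Suc k)))\<^sup>2 * real (m (Suc k)) / 2 ^ m k * 2 powr (- (4 / 5) * w k)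
      \<le> 20 / real (q k)" for k
  proof -
    have w: "8 * real (q k) \<le> w k" "real (q (Suc k)) \<le> 2 powr (w k / 4)"
      using quality[of k] q_Suc[of k] by (auto simp: w_def)
    have "(real (q (Suc k)))\<^sup>2 * real (m (Suc k)) / 2 ^ m k \<le> (real (q (Suc k)))\<^sup>2 * real (m (Suc k)) / 1"
      by (intro divide_left_mono) auto
    also have "\<dots> \<le> (2 powr (w k / 4))\<^sup>2 * 2 powr (w k / 4)"
      using w(2) mq[of "Suc k"] by (simp, intro mult_mono power_mono) auto
    also have "\<dots> = 2 powr (3 / 4 * w k)"
      by (simp add: power2_eq_square flip: powr_add)
    finally have "(real (q (Suc k)))\<^sup>2 * real (m (Suc k)) / 2 ^ m k * 2 powr (- (4 / 5) * w k)
        \<le> 2 powr (3 / 4 * w k) * 2 powr (- (4 / 5) * w k)"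
      by (rule mult_right_mono) simp
    \<comment> \<open>What remains is 4/5 - 3/4 = 1/20.\<close>
    also have "\<dots> = 1 / 2 powr (w k / 20)"
      by (simp flip: powr_add powr_minus_divide)
    also have "\<dots> \<le> 1 / (w k / 20)"
      using le_2_powr[of "w k / 20"] w(1) q1[of k] by (intro divide_left_mono) auto
    also have "\<dots> = 20 / w k"
      by simp
    also have "\<dots> \<le> 20 / real (q k)"
      using w(1) q1[of k] by (intro divide_left_mono) auto
    finally show ?thesis .
  qed
  have "filterlim (\<lambda>k. real (q k)) at_top sequentially"
    by (rule filterlim_compose[OF filterlim_real_sequentially q_lim])
  then have "(\<lambda>k. 20 / real (q k)) \<longlonglongrightarrow> 0"
    by (intro tendsto_divide_0[OF tendsto_const] filterlim_at_top_imp_at_infinity)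
  then have "(\<lambda>k. (real (q (Suc k)))\<^sup>2 * real (m (Suc k)) / 2 ^ m k * 2 powr (- (4 / 5) * w k)) \<longlonglongrightarrow> 0"
    by (rule tendsto_sandwich[OF _ _ tendsto_const, rotated 2]) (use bound in auto)
  moreover have "5 / 4 \<le> approx_quality y (p k) (q k)" for k
    using quality[of k] q1[of k] by linarith
  ultimately show ?thesis
    using level ne q_lim unfolding w_def by (intro question_mark_derivative_0[of p q m y])
qed

text \<open>New denominators are 2^m, so their growth condition concerns only the exponents m_{k+1}
  < q_{k+1} <= 2^(w_k/4), while the new quality is of the order 2^(w_k - m_k).\<close>

lemma rapidly_approximable_question_mark:
  assumes "rapidly_approximable y"
  shows "rapidly_approximable (question_mark y)"
proof -
  obtain p q m :: "nat \<Rightarrow> nat" where q_lim: "filterlim q at_top sequentially"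
    and pq: "\<forall>k. has_level (p k) (q k) (m k) \<and> y \<noteq> real (p k) / real (q k) \<and>
      8 * real (q k) \<le> approx_quality y (p k) (q k) \<and>
      real (q (Suc k)) \<le> 2 powr (approx_quality y (p k) (q k) / 4)"
    using rapidly_approximable_levels[OF assms] by blast
  have level: "has_level (p k) (q k) (m k)" and ne: "y \<noteq> real (p k) / real (q k)"
    and quality: "8 * real (q k) \<le> approx_quality y (p k) (q k)"
    and q_Suc: "real (q (Suc k)) \<le> 2 powr (approx_quality y (p k) (q k) / 4)" for k
    using pq by blast+
  define w where "w = (\<lambda>k. approx_quality y (p k) (q k))"
  have mq: "real (m k) + 1 \<le> real (q k)" and qm: "q k \<le> 2 ^ m k" for k
    using level[of k] by (auto simp: has_level_def)
  have w: "8 * real (m k) + 8 \<le> w k" for k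
    using mq[of k] quality[of k] unfolding w_def by linarith
  have "\<exists>P. 0 < P \<and> P < 2 ^ m k \<and> coprime P (2 ^ m k) \<and> question_mark y \<noteq> real P / real (2 ^ m k) \<and>
      2 powr (w k - real (m k) - 2) \<le> approx_quality (question_mark y) P (2 ^ m k)" for k
  proof -
    have "1 \<le> approx_quality y (p k) (q k)"
      using w[of k] unfolding w_def by linarith
    from has_level_image[OF level[of k] ne[of k] this] show ?thesis
      unfolding w_def by blast
  qed
  then obtain P where P: "\<And>k. 0 < P k \<and> P k < 2 ^ m k \<and> coprime (P k) (2 ^ m k) \<and>
      question_mark y \<noteq> real (P k) / real (2 ^ m k) \<and>
      2 powr (w k - real (m k) - 2) \<le> approx_quality (question_mark y) (P k) (2 ^ m k)"
    by metis
  have "8 * real (2 ^ m k) \<le> approx_quality (question_mark y) (P k) (2 ^ m k)" for k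
  proof -
    have "8 * real (2 ^ m k) = 2 powr (real (m k) + 3)"
      by (simp add: powr_add powr_realpow)
    also have "\<dots> \<le> 2 powr (w k - real (m k) - 2)"
      using w[of k] by simp
    finally show ?thesis
      using P[of k] by linarith
  qed
  moreover have "real (2 ^ m (Suc k)) \<le> 2 powr (approx_quality (question_mark y) (P k) (2 ^ m k) / 4)" for k
  proof -
    have "real (m (Suc k)) \<le> 2 powr (w k / 4)"
      using mq[of "Suc k"] q_Suc[of k] unfolding w_def by linarith
    also have "\<dots> \<le> 2 powr (w k - real (m k) - 4)"
      using w[of k] by simp
    also have "\<dots> = 2 powr (w k - real (m k) - 2) / 4"
      by (simp add: powr_diff)
    finally have "real (m (Suc k)) \<le> approx_quality (question_mark y) (P k) (2 ^ m k) / 4"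
      using P[of k] by linarith
    then show ?thesis
      by (simp flip: powr_realpow)
  qed
  moreover have "filterlim (\<lambda>k. 2 ^ m k :: nat) at_top sequentially"
    using qm by (intro filterlim_at_top_mono[OF q_lim]) auto
  moreover have "0 < question_mark y" "question_mark y < 1"
    using assms question_mark_pos_less_1 by (auto simp: rapidly_approximable_def)
  ultimately show ?thesis
    unfolding rapidly_approximable_def using P by (intro conjI exI[of _ P] exI[of _ "\<lambda>k. 2 ^ m k"]) auto
qed

section \<open>The set \<open>M\<close>\<close>

text \<open>The difference kappa2 - 4 is L_4 / (L_4 - L_5). Here L_4 >= 0 because (4 + sqrt 20)/2 >=
  4, and L_5 < 0 because ((5 + sqrt 29)/2)^2 < (11/2)^2 < 2^5.\<close>

lemma kappa2_ge_4: "4 \<le> kappa2"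
proof -
  have "4 \<le> sqrt (4\<^sup>2 + 4)"
    by (rule real_le_rsqrt) simp
  then have "ln 4 \<le> ln ((4 + sqrt (4\<^sup>2 + 4)) / 2 :: real)"
    by (subst ln_le_cancel_iff) auto
  moreover have "ln 4 = 2 * ln (2::real)"
    using ln_realpow[of "2::real" 2] by simp
  ultimately have L4: "0 \<le> L_const 4"
    by (simp add: L_const_def)
  have pos: "0 < (5 + sqrt (5\<^sup>2 + 4)) / 2"
    by (simp add: add_pos_nonneg)
  have "sqrt (5\<^sup>2 + 4) < 6"
    by (rule real_less_lsqrt) auto
  then have "((5 + sqrt (5\<^sup>2 + 4)) / 2)\<^sup>2 < (11 / 2 :: real)\<^sup>2"
    by (intro power_strict_mono) (auto intro: add_nonneg_nonneg)
  also have "\<dots> < 2 ^ 5"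
    by (simp add: power2_eq_square)
  finally have "ln (((5 + sqrt (5\<^sup>2 + 4)) / 2)\<^sup>2) < ln (2 ^ 5 :: real)"
    using pos by (subst ln_less_cancel_iff) (auto intro!: zero_less_power)
  then have "2 * ln ((5 + sqrt (5\<^sup>2 + 4)) / 2) < 5 * ln (2 :: real)"
    using pos by (simp only: ln_realpow of_nat_numeral)
  then have L5: "L_const 5 < 0"
    by (simp add: L_const_def)
  show ?thesis
    using L4 L5 by (simp add: kappa2_def neg_le_divide_eq)
qed

section \<open>Quality and level of convergents\<close>

lemma prod_list_Suc_le_power: "prod_list (map Suc as) \<le> 2 ^ sum_list as"
proof (induction as)
  case (Cons a as)
  have "Suc a \<le> 2 ^ a"
    by (simp add: Suc_leI)
  then have "Suc a * prod_list (map Suc as) \<le> 2 ^ a * 2 ^ sum_list as"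
    using Cons by (rule mult_le_mono)
  then show ?case
    by (simp add: power_add)
qed simp

text \<open>Longer prefixes have a tail between 1/(a N + 1) and 1/(a N) after the first
  \<open>N\<close> digits, so their distance from p/q obeys bounds that survive the limit: the upper
  one gives the quality, the positive lower one separates \<open>x\<close> from p/q.\<close>

lemma is_cf_convergent:
  assumes "is_cf a x"
  obtains p q :: nat where "0 < q" "coprime p q" "q \<le> prod_list (map Suc (map a [0..<N]))"
    "cf_fin (map a [0..<N]) = real p / real q" "x \<noteq> real p / real q"
    "real (a N) \<le> approx_quality x p q"
proof -
  have a_pos: "0 < a j" for j
    using assms by (simp add: is_cf_def)
  have lim: "(\<lambda>n. cf_fin (map a [0..<n])) \<longlonglongrightarrow> x"
    using assms by (simp add: is_cf_def)
  have pos: "\<forall>j\<in>set (map a [0..<N]). 0 < j"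
    using a_pos by auto
  obtain p q p' q' :: nat where m:
    "0 < q" "coprime p q" "q \<le> prod_list (map Suc (map a [0..<N]))"
    "cf_fin (map a [0..<N]) = real p / real q"
    "\<bar>real p' * real q - real p * real q'\<bar> = 1"
    "\<And>t. 0 \<le> t \<Longrightarrow> cf_tail (map a [0..<N]) t = (real p + real p' * t) / (real q + real q' * t)"
    by (rule cf_fin_moebius[OF pos]) blast
  define lo where "lo = 1 / (real (a N) + 1) / (real q * (real q + real q'))"
  define hi where "hi = 1 / real (a N) / (real q)\<^sup>2"
  have bounds: "lo \<le> \<bar>cf_fin (map a [0..<n]) - real p / real q\<bar> \<and> \<bar>cf_fin (map a [0..<n]) - real p / real q\<bar> \<le> hi"
    if "Suc N \<le> n" for n
  proof -
    define c where "c = cf_fin (map a [Suc N..<n])"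
    define t where "t = 1 / (real (a N) + c)"
    have "\<forall>j\<in>set (map a [Suc N..<n]). 0 < j"
      using a_pos by auto
    from cf_fin_bounds[OF this] have c: "0 \<le> c" "c \<le> 1"
      by (auto simp: c_def)
    have aN: "1 \<le> real (a N)"
      using a_pos[of N] by simp
    have t: "0 < t" "t \<le> 1" "1 / (real (a N) + 1) \<le> t" "t \<le> 1 / real (a N)"
      using c aN by (auto simp: t_def intro!: divide_left_mono)
    have "[0..<n] = [0..<N] @ N # [Suc N..<n]"
      using that by (metis Suc_le_lessD le_add1 add_0 le_add_diff_inverse less_imp_le_nat upt_add_eq_append upt_conv_Cons zero_le)
    then have "cf_fin (map a [0..<n]) = cf_tail (map a [0..<N]) t"
      by (simp add: cf_fin_append t_def c_def)
    then have eq: "\<bar>cf_fin (map a [0..<n]) - real p / real q\<bar> = t / (real q * (real q + real q' * t))"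
      using m(6)[of t] cf_tail_minus[OF m(1) _ m(5), of t] t by simp
    have "real q' * t \<le> real q'"
      using t by (simp add: mult_left_le)
    then have "lo \<le> t / (real q * (real q + real q' * t))"
      unfolding lo_def using t m(1) by (intro frac_le mult_left_mono mult_pos_pos add_pos_nonneg) auto
    moreover have "t / (real q * (real q + real q' * t)) \<le> hi"
      unfolding hi_def power2_eq_square using t m(1) by (intro frac_le mult_left_mono mult_pos_pos) auto
    ultimately show ?thesis
      unfolding eq by blast
  qed
  have lim': "(\<lambda>n. \<bar>cf_fin (map a [0..<n]) - real p / real q\<bar>) \<longlonglongrightarrow> \<bar>x - real p / real q\<bar>"
    by (intro tendsto_intros lim)
  have lo: "lo \<le> \<bar>x - real p / real q\<bar>"
    by (rule LIMSEQ_le_const[OF lim']) (use bounds in blast)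
  have hi: "\<bar>x - real p / real q\<bar> \<le> hi"
    by (rule LIMSEQ_le_const2[OF lim']) (use bounds in blast)
  have "0 < lo"
    using m(1) by (auto simp: lo_def intro!: divide_pos_pos mult_pos_pos add_pos_nonneg)
  then have ne: "x \<noteq> real p / real q"
    using lo by auto
  have "real (a N) = 1 / ((real q)\<^sup>2 * hi)"
    using m(1) by (simp add: hi_def)
  also have "\<dots> \<le> approx_quality x p q"
    unfolding approx_quality_def using hi ne m(1) a_pos[of N]
    by (intro divide_left_mono mult_left_mono mult_pos_pos) (auto simp: hi_def)
  finally show ?thesis
    using that m ne by blast
qed

lemma odd_part_unique:
  fixes v :: real and P Q :: int
  assumes "odd P" "2 ^ m * v = of_int P" "odd Q" "2 ^ n * v = of_int Q"
  shows "m = n"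
proof -
  have aux: "\<not> i < j" if "odd P" "2 ^ i * v = of_int P" "odd Q" "2 ^ j * v = of_int Q" for i j and P Q :: int
  proof
    assume "i < j"
    then obtain k where "j = Suc (i + k)"
      using less_imp_Suc_add by blast
    then have "2 ^ j * v = 2 * 2 ^ k * (2 ^ i * v)"
      by (simp add: power_add)
    then have "real_of_int Q = of_int (2 * 2 ^ k * P)"
      using that by simp
    then have "Q = 2 * 2 ^ k * P"
      by (simp only: of_int_eq_iff)
    then show False
      using that by simp
  qed
  show ?thesis
    using aux[OF assms] aux[OF assms(3,4,1,2)] by linarith
qed

text \<open>The level found by Stern-Brocot descent and the digit sum both make the scaled value an
  odd integer, so they must match. No comparison of the descent with the expansion is
  required.\<close>

lemma has_level_cf_fin:
  assumes "\<forall>a\<in>set as. 0 < a" "2 \<le> sum_list as" "0 < q" "coprime p q" "cf_fin as = real p / real q"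
  shows "has_level p q (sum_list as - 1)"
proof -
  have "as \<noteq> []"
    using assms(2) by auto
  then have "0 < cf_fin as" "cf_fin as < 1"
    using cf_fin_bounds[OF assms(1)] cf_fin_less_1[OF assms(1,2)] by auto
  then have "0 < p" "p < q"
    using assms(3,5) by (auto simp: zero_less_divide_iff)
  then obtain m where m: "has_level p q m"
    using has_level_exists assms(4) by blast
  then obtain P :: int where P: "odd P" "2 ^ m * question_mark (real p / real q) = of_int P"
    by (auto simp: has_level_def)
  obtain Q :: int where Q: "odd Q" "2 ^ (sum_list as - 1) * question_mark (real p / real q) = of_int Q"
    using odd_qm_list[OF assms(1) \<open>as \<noteq> []\<close>] question_mark_cf_fin[OF assms(1)] assms(5) by auto
  have "m = sum_list as - 1"
    using odd_part_unique[OF P Q] .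
  then show ?thesis
    using m by simp
qed

section \<open>Prefixes that end just before a large partial quotient\<close>

definition block_prefix :: "(nat \<Rightarrow> nat list) \<Rightarrow> (nat \<Rightarrow> nat) \<Rightarrow> nat \<Rightarrow> nat list" where
  "block_prefix A \<tau> k = concat (map (\<lambda>i. A i @ [\<tau> i]) [0..<k]) @ A k"

lemma block_prefix_Suc: "block_prefix A \<tau> (Suc k) = block_prefix A \<tau> k @ \<tau> k # A (Suc k)"
  by (simp add: block_prefix_def)

lemma sum_list_block_prefix: "sum_list (block_prefix A \<tau> k) = block_sigma A \<tau> k"
  by (induction k) (simp_all add: block_prefix_Suc block_sigma_def, simp add: block_prefix_def)

text \<open>Concatenations of initial blocks extend one another, so any number of blocks that
  reaches index \<open>n\<close> shows the same entry there as the n + 1 blocks of the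
  definition.\<close>

lemma block_seq_nth:
  assumes "n < length (concat (map (\<lambda>i. A i @ [\<tau> i]) [0..<k]))"
  shows "block_seq A \<tau> n = concat (map (\<lambda>i. A i @ [\<tau> i]) [0..<k]) ! n"
proof -
  define L where "L = (\<lambda>k. concat (map (\<lambda>i. A i @ [\<tau> i]) [0..<k]))"
  have mono: "L j ! n = L i ! n" if "i \<le> j" "n < length (L i)" for i j
  proof -
    have "L j = L i @ concat (map (\<lambda>i. A i @ [\<tau> i]) [i..<j])"
      using that(1) upt_add_eq_append[of 0 i "j - i"] by (simp add: L_def)
    then show ?thesis
      using that(2) by (simp add: nth_append)
  qed
  have len: "j \<le> length (L j)" for j
    by (induction j) (auto simp: L_def)
  show ?thesis
    using mono[of "Suc n" k] mono[of k "Suc n"] len[of "Suc n"] assms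
    unfolding block_seq_def L_def[symmetric] by (metis L_def Suc_le_lessD nat_le_linear)
qed

lemma block_seq_prefix:
  "map (block_seq A \<tau>) [0..<length (block_prefix A \<tau> k)] = block_prefix A \<tau> k"
  "block_seq A \<tau> (length (block_prefix A \<tau> k)) = \<tau> k"
proof -
  define L where "L = concat (map (\<lambda>i. A i @ [\<tau> i]) [0..<Suc k])"
  have L: "L = block_prefix A \<tau> k @ [\<tau> k]"
    by (simp add: L_def block_prefix_def)
  have nth: "block_seq A \<tau> n = L ! n" if "n < length L" for n
    using block_seq_nth[of n A \<tau> "Suc k"] that by (simp add: L_def)
  show "map (block_seq A \<tau>) [0..<length (block_prefix A \<tau> k)] = block_prefix A \<tau> k"
    by (rule nth_equalityI) (auto simp: nth L nth_append)
  show "block_seq A \<tau> (length (block_prefix A \<tau> k)) = \<tau> k"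
    using nth[of "length (block_prefix A \<tau> k)"] by (simp add: L)
qed

lemma four_times_le_power: "9 \<le> s \<Longrightarrow> 4 * s \<le> 2 ^ (s - 3)" for s :: nat
proof (induction s rule: nat_induct_at_least)
  case (Suc n)
  have "Suc n - 3 = Suc (n - 3)"
    using Suc.hyps by simp
  then show ?case
    using Suc by simp
qed simp

text \<open>Here \<open>t k\<close> is the digit sum of the block after \<open>\<tau> k\<close>. Its
  coefficient 3 comes from kappa2 - 1 >= 3, and the two copies of \<open>S k\<close> from \<tau> = S
  + s with s > S + ..; strictness over the integers turns 2 into 3.\<close>

lemma M_set_approximants:
  assumes "x \<in> M_set"
  obtains p q S \<tau> t :: "nat \<Rightarrow> nat" where
    "\<And>k. has_level (p k) (q k) (S k - 1)" "\<And>k. x \<noteq> real (p k) / real (q k)"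
    "\<And>k. k + 8 \<le> S k" "\<And>k. S (Suc k) = S k + \<tau> k + t k"
    "\<And>k. 2 * S k + 3 * t k + 3 \<le> \<tau> k"
    "\<And>k. real (\<tau> k) \<le> approx_quality x (p k) (q k)"
    "\<And>k. q (Suc k) \<le> 2 ^ (S k + t k) * (\<tau> k + 1)"
proof -
  obtain A \<tau> where A: "\<And>k. \<forall>a\<in>set (A k). 0 < a" and \<tau>: "\<And>k. 0 < \<tau> k"
    and cf: "is_cf (block_seq A \<tau>) x"
    and s: "\<And>k. \<exists>s>0. \<tau> k = block_sigma A \<tau> k + s \<and>
        real s > (kappa2 - 1) * real (sum_list (A (Suc k))) + real (block_sigma A \<tau> k) + 2"
    using assms unfolding M_set_def by blast
  define S where "S = block_sigma A \<tau>"
  have S_Suc: "S (Suc k) = S k + \<tau> k + sum_list (A (Suc k))" for k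
    by (simp add: S_def block_sigma_def)
  have S_ge: "k \<le> S k" for k
  proof (induction k)
    case (Suc k)
    then show ?case
      using \<tau>[of k] by (simp add: S_Suc)
  qed simp
  have \<tau>_ge: "2 * S k + 3 * sum_list (A (Suc k)) + 3 \<le> \<tau> k" for k
  proof -
    obtain s where s: "\<tau> k = S k + s"
      "real s > (kappa2 - 1) * real (sum_list (A (Suc k))) + real (S k) + 2"
      using s[of k] unfolding S_def by blast
    have "3 * real (sum_list (A (Suc k))) \<le> (kappa2 - 1) * real (sum_list (A (Suc k)))"
      using kappa2_ge_4 by (intro mult_right_mono) auto
    then have "real (3 * sum_list (A (Suc k)) + S k + 2) < real s"
      using s(2) by simp
    then have "3 * sum_list (A (Suc k)) + S k + 2 < s"
      by (simp only: of_nat_less_iff)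
    then show ?thesis
      using s(1) by simp
  qed
  have "\<exists>p q. 0 < q \<and> coprime p q \<and> q \<le> prod_list (map Suc (block_prefix A \<tau> k)) \<and>
      cf_fin (block_prefix A \<tau> k) = real p / real q \<and> x \<noteq> real p / real q \<and>
      real (\<tau> k) \<le> approx_quality x p q" for k
    using is_cf_convergent[OF cf, of "length (block_prefix A \<tau> k)"]
    unfolding block_seq_prefix by metis
  then obtain p q where pq: "\<And>k. 0 < q k \<and> coprime (p k) (q k) \<and>
      q k \<le> prod_list (map Suc (block_prefix A \<tau> k)) \<and>
      cf_fin (block_prefix A \<tau> k) = real (p k) / real (q k) \<and> x \<noteq> real (p k) / real (q k) \<and>
      real (\<tau> k) \<le> approx_quality x (p k) (q k)"
    by metis
  \<comment> \<open>The first prefixes may be empty or have digit sum 1, where no level exists; a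
    shift of the index skips them and gives room for numerical estimates.\<close>
  obtain c :: nat where c: "8 \<le> c"
    by blast
  have S_shift: "k + 8 \<le> S (k + c)" for k
    using S_ge[of "k + c"] c by linarith
  have pos: "\<forall>a\<in>set (block_prefix A \<tau> k). 0 < a" for k
    using A \<tau> by (auto simp: block_prefix_def)
  have "has_level (p k) (q k) (S k - 1)" if "2 \<le> k" for k
    using has_level_cf_fin[OF pos, of k "q k" "p k"] pq[of k] S_ge[of k] that
    unfolding sum_list_block_prefix S_def by simp
  moreover have "q (Suc k) \<le> 2 ^ (S k + sum_list (A (Suc k))) * (\<tau> k + 1)" for k
  proof -
    have "q (Suc k) \<le> prod_list (map Suc (block_prefix A \<tau> k)) * (\<tau> k + 1) * prod_list (map Suc (A (Suc k)))"
      using pq[of "Suc k"] by (simp add: block_prefix_Suc algebra_simps)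
    also have "\<dots> \<le> 2 ^ S k * (\<tau> k + 1) * 2 ^ sum_list (A (Suc k))"
      using prod_list_Suc_le_power[of "block_prefix A \<tau> k"] prod_list_Suc_le_power[of "A (Suc k)"]
      unfolding sum_list_block_prefix S_def by (intro mult_le_mono) auto
    finally show ?thesis
      by (simp add: power_add algebra_simps)
  qed
  ultimately show ?thesis
    using pq \<tau>_ge S_Suc S_shift c
    by (intro that[of "\<lambda>k. p (k + c)" "\<lambda>k. q (k + c)" "\<lambda>k. S (k + c)" "\<lambda>k. \<tau> (k + c)" "\<lambda>k. sum_list (A (Suc (k + c)))"])
       (simp_all del: mult_Suc_right)
qed

section \<open>Derivative and image at points of the set\<close>

lemma M_set_derivative_0:
  assumes "x \<in> M_set"
  shows "(question_mark has_real_derivative 0) (at x)"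
proof -
  obtain p q S \<tau> t :: "nat \<Rightarrow> nat" where ap:
    "\<And>k. has_level (p k) (q k) (S k - 1)" "\<And>k. x \<noteq> real (p k) / real (q k)"
    "\<And>k. k + 8 \<le> S k" "\<And>k. S (Suc k) = S k + \<tau> k + t k"
    "\<And>k. 2 * S k + 3 * t k + 3 \<le> \<tau> k"
    "\<And>k. real (\<tau> k) \<le> approx_quality x (p k) (q k)"
    "\<And>k. q (Suc k) \<le> 2 ^ (S k + t k) * (\<tau> k + 1)"
    by (rule M_set_approximants[OF assms]) blast
  define w where "w = (\<lambda>k. approx_quality x (p k) (q k))"
  have \<tau>_ge: "k + 8 \<le> \<tau> k" for k
    using ap(3,5)[of k] by linarith
  have bound: "(real (q (Suc k)))\<^sup>2 * real (S (Suc k) - 1) / 2 ^ (S k - 1) * 2 powr (- (4 / 5) * w k)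
      \<le> 10 ^ 7 / real (k + 8)" for k
  proof -
    define T where "T = real (\<tau> k)"
    have T: "8 \<le> T" "real k + 8 \<le> T" "T \<le> w k"
      using \<tau>_ge[of k] ap(6)[of k] by (auto simp: T_def w_def)
    have ST: "real (S k) + 2 * real (t k) \<le> 2 / 3 * T"
    proof -
      have "real (2 * S k + 3 * t k + 3) \<le> T"
        using ap(5)[of k] unfolding T_def by (simp only: of_nat_le_iff)
      then show ?thesis
        by simp
    qed
    have S1: "2 / 2 ^ S k = (1 / 2 ^ (S k - 1) :: real)"
      using ap(3)[of k] by (cases "S k") auto
    have "real (q (Suc k)) \<le> real (2 ^ (S k + t k) * (\<tau> k + 1))"
      using ap(7)[of k] by (simp only: of_nat_le_iff)
    then have q: "real (q (Suc k)) \<le> 2 ^ (S k + t k) * (T + 1)"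
      by (simp add: T_def algebra_simps)
    have "S (Suc k) - 1 \<le> 2 * (\<tau> k + 1)"
      using ap(4,5)[of k] by simp
    then have "real (S (Suc k) - 1) \<le> real (2 * (\<tau> k + 1))"
      by (simp only: of_nat_le_iff)
    then have m: "real (S (Suc k) - 1) \<le> 2 * (T + 1)"
      by (simp add: T_def)
    have "(real (q (Suc k)))\<^sup>2 * real (S (Suc k) - 1) / 2 ^ (S k - 1)
        = (real (q (Suc k)))\<^sup>2 * real (S (Suc k) - 1) * (2 / 2 ^ S k)"
      unfolding S1 by simp
    also have "\<dots> \<le> (2 ^ (S k + t k) * (T + 1))\<^sup>2 * (2 * (T + 1)) * (2 / 2 ^ S k)"
      using q m by (intro mult_right_mono mult_mono power_mono) auto
    also have "\<dots> = 4 * (T + 1) ^ 3 * 2 powr (real (S k) + 2 * real (t k))"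
    proof -
      have "2 powr (real (S k) + 2 * real (t k)) = 2 ^ (S k + t k + t k)"
        by (simp add: add.commute flip: powr_realpow)
      then show ?thesis
        by (simp add: power_add power2_eq_square power3_eq_cube)
    qed
    \<comment> \<open>The 30 is chosen so that the cubed polynomial factor costs only (T + 1)/10 in
      the exponent: 2/3 + 1/10 falls short of 4/5 by 1/30.\<close>
    also have "\<dots> \<le> 4 * (30 * 2 powr ((T + 1) / 30)) ^ 3 * 2 powr (2 / 3 * T)"
      using T ST le_2_powr[of "(T + 1) / 30"] by (intro mult_mono mult_left_mono power_mono powr_mono) auto
    also have "\<dots> = 108000 * 2 powr (2 / 3 * T + (T + 1) / 10)"
    proof -
      have "(2 powr ((T + 1) / 30)) ^ 3 = 2 powr ((T + 1) / 10)"
        by (simp add: power3_eq_cube flip: powr_add)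
      then show ?thesis
        by (simp add: power_mult_distrib powr_add)
    qed
    finally have "(real (q (Suc k)))\<^sup>2 * real (S (Suc k) - 1) / 2 ^ (S k - 1) * 2 powr (- (4 / 5) * w k)
        \<le> 108000 * 2 powr (2 / 3 * T + (T + 1) / 10) * 2 powr (- (4 / 5) * T)"
      using T by (intro mult_mono) auto
    also have "\<dots> = 108000 * 2 powr (1 / 10 - T / 30)"
    proof -
      have "2 / 3 * T + (T + 1) / 10 + - (4 / 5) * T = 1 / 10 - T / 30"
        by (simp add: field_simps)
      then show ?thesis
        by (simp only: mult.assoc powr_add[symmetric])
    qed
    also have "\<dots> \<le> 108000 * (2 * (30 / T))"
    proof (rule mult_left_mono)
      have "2 powr (1 / 10 - T / 30) = 2 powr (1 / 10) * (1 / 2 powr (T / 30))"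
        by (simp add: powr_diff)
      also have "\<dots> \<le> 2 powr 1 * (1 / (T / 30))"
        using T le_2_powr[of "T / 30"] by (intro mult_mono powr_mono divide_left_mono) auto
      finally show "2 powr (1 / 10 - T / 30) \<le> 2 * (30 / T)"
        by simp
    qed simp
    also have "\<dots> \<le> 10 ^ 7 / T"
      using T by (simp add: field_simps)
    also have "\<dots> \<le> 10 ^ 7 / real (k + 8)"
      using T by (intro divide_left_mono) auto
    finally show ?thesis .
  qed
  have "(\<lambda>k. 10 ^ 7 / real (k + 8)) \<longlonglongrightarrow> 0"
    by (rule LIMSEQ_ignore_initial_segment[OF lim_const_over_n])
  then have small: "(\<lambda>k. (real (q (Suc k)))\<^sup>2 * real (S (Suc k) - 1) / 2 ^ (S k - 1)
      * 2 powr (- (4 / 5) * w k)) \<longlonglongrightarrow> 0"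
    by (rule tendsto_sandwich[OF _ _ tendsto_const, rotated 2]) (use bound in auto)
  have "filterlim q at_top sequentially"
  proof (rule filterlim_at_top_mono[OF filterlim_ident])
    have "k \<le> q k" for k
      using ap(1,3)[of k] by (auto simp: has_level_def)
    then show "\<forall>\<^sub>F k in sequentially. k \<le> q k"
      by simp
  qed
  moreover have "5 / 4 \<le> approx_quality x (p k) (q k)" for k
    using \<tau>_ge[of k] ap(6)[of k] by linarith
  ultimately show ?thesis
    using small ap(1,2) unfolding w_def
    by (intro question_mark_derivative_0[of p q "\<lambda>k. S k - 1" x])
qed

lemma M_set_rapidly_approximable:
  assumes "x \<in> M_set"
  shows "rapidly_approximable (question_mark x)"
proof -
  obtain p q S \<tau> t :: "nat \<Rightarrow> nat" where ap:
    "\<And>k. has_level (p k) (q k) (S k - 1)" "\<And>k. x \<noteq> real (p k) / real (q k)"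
    "\<And>k. k + 8 \<le> S k" "\<And>k. S (Suc k) = S k + \<tau> k + t k"
    "\<And>k. 2 * S k + 3 * t k + 3 \<le> \<tau> k"
    "\<And>k. real (\<tau> k) \<le> approx_quality x (p k) (q k)"
    by (rule M_set_approximants[OF assms]) blast
  \<comment> \<open>The surplus of quality over digit sum. It becomes the exponent of the quality of
    the image, and s >= S + 3 t + 3 settles both conditions.\<close>
  define s where "s = (\<lambda>k. \<tau> k - S k)"
  have s: "\<tau> k = S k + s k" "S k + 3 * t k + 3 \<le> s k" "11 \<le> s k" for k
    using ap(3,5)[of k] by (auto simp: s_def)
  have "\<exists>P. 0 < P \<and> P < 2 ^ (S k - 1) \<and> coprime P (2 ^ (S k - 1)) \<and>
      question_mark x \<noteq> real P / real (2 ^ (S k - 1)) \<and>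
      2 ^ (s k - 1) \<le> approx_quality (question_mark x) P (2 ^ (S k - 1))" for k
  proof -
    have "1 \<le> approx_quality x (p k) (q k)"
      using ap(6)[of k] s[of k] by linarith
    from has_level_image[OF ap(1,2)[of k] this] obtain P where P: "0 < P" "P < 2 ^ (S k - 1)"
      "coprime P (2 ^ (S k - 1))" "question_mark x \<noteq> real P / real (2 ^ (S k - 1))"
      "2 powr (approx_quality x (p k) (q k) - real (S k - 1) - 2)
        \<le> approx_quality (question_mark x) P (2 ^ (S k - 1))"
      by blast
    have "real (s k - 1) \<le> approx_quality x (p k) (q k) - real (S k - 1) - 2"
      using ap(3,6)[of k] s[of k] by linarith
    then have "2 powr real (s k - 1) \<le> 2 powr (approx_quality x (p k) (q k) - real (S k - 1) - 2)"
      by simp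
    then have "2 ^ (s k - 1) \<le> approx_quality (question_mark x) P (2 ^ (S k - 1))"
      using P(5) by (simp only: powr_realpow)
    then show ?thesis
      using P by blast
  qed
  then obtain P where P: "\<And>k. 0 < P k \<and> P k < 2 ^ (S k - 1) \<and> coprime (P k) (2 ^ (S k - 1)) \<and>
      question_mark x \<noteq> real (P k) / real (2 ^ (S k - 1)) \<and>
      2 ^ (s k - 1) \<le> approx_quality (question_mark x) (P k) (2 ^ (S k - 1))"
    by metis
  have "8 * real (2 ^ (S k - 1)) \<le> approx_quality (question_mark x) (P k) (2 ^ (S k - 1))" for k
  proof -
    have "8 * real (2 ^ (S k - 1)) = 2 ^ (S k - 1 + 3)"
      by (simp add: power_add)
    also have "\<dots> \<le> (2 :: real) ^ (s k - 1)"
      using s[of k] ap(3)[of k] by (intro power_increasing) auto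
    finally show ?thesis
      using P[of k] by linarith
  qed
  moreover have "real (2 ^ (S (Suc k) - 1)) \<le> 2 powr (approx_quality (question_mark x) (P k) (2 ^ (S k - 1)) / 4)" for k
  proof -
    have "S (Suc k) - 1 \<le> 4 * s k"
      using ap(4)[of k] s[of k] by simp
    also have "\<dots> \<le> 2 ^ (s k - 3)"
      using s[of k] by (intro four_times_le_power) auto
    finally have "real (S (Suc k) - 1) \<le> real (2 ^ (s k - 3))"
      by (simp only: of_nat_le_iff)
    also have "\<dots> = 2 ^ (s k - 1) / 4"
    proof -
      have "s k - 1 = s k - 3 + 2"
        using s(3)[of k] by simp
      then show ?thesis
        by (simp add: power_add)
    qed
    finally have "real (S (Suc k) - 1) \<le> approx_quality (question_mark x) (P k) (2 ^ (S k - 1)) / 4"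
      using P[of k] by linarith
    then show ?thesis
      by (simp flip: powr_realpow)
  qed
  moreover have "filterlim (\<lambda>k. 2 ^ (S k - 1) :: nat) at_top sequentially"
  proof (rule filterlim_at_top_mono[OF filterlim_ident])
    have "k \<le> 2 ^ (S k - 1)" for k
    proof -
      have "k \<le> S k - 1"
        using ap(3)[of k] by simp
      also have "\<dots> \<le> 2 ^ (S k - 1)"
        by (simp add: less_imp_le_nat)
      finally show ?thesis .
    qed
    then show "\<forall>\<^sub>F k in sequentially. k \<le> 2 ^ (S k - 1)"
      by simp
  qed
  moreover have "0 < question_mark x" "question_mark x < 1"
    using assms question_mark_pos_less_1 by (auto simp: M_set_def)
  ultimately show ?thesis
    unfolding rapidly_approximable_def using P
    by (intro conjI exI[of _ P] exI[of _ "\<lambda>k. 2 ^ (S k - 1)"]) auto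
qed

theorem theorem1:
  fixes x0 :: real and n :: nat
  assumes "x0 \<in> M_set" and "n \<ge> 1"
  shows "((question_mark ^^ n) has_real_derivative 0) (at x0)"
  using assms(2)
proof (induction n rule: nat_induct_at_least)
  case base
  then show ?case
    using M_set_derivative_0[OF assms(1)] by simp
next
  case (Suc n)
  \<comment> \<open>This inner induction starts at n = 1: rapid approximability is established for
    the image of \<open>x0\<close>, not for \<open>x0\<close>.\<close>
  have "rapidly_approximable ((question_mark ^^ n) x0)"
    using Suc.hyps
  proof (induction n rule: nat_induct_at_least)
    case base
    then show ?case
      using M_set_rapidly_approximable[OF assms(1)] by simp
  next
    case (Suc n)
    then show ?case
      using rapidly_approximable_question_mark by simp
  qed
  from DERIV_chain[OF rapidly_approximable_derivative_0[OF this] Suc.IH]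
  show ?case
    by (simp add: comp_def)
qed

end
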